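(* Let $\mu_1,\mu_2$ be sigma-finite positive measures on $(X,\mathcal F)$, and let $W^{(\mu_1)},W^{(\mu_2)}$ be the associated Brownian motions on the universal probability space $(\Omega,\mathcal C,\mathbb P)$. For $B\in\mathcal F^{\rm fin}(\mu_2)$ and $A\in\mathcal F^{\rm fin}(\mu_1)$ set $$P(x,B)=\frac{{\rm d}\,\mathbb E(W^{(\mu_1)}_\cdot W_B^{(\mu_2)})}{{\rm d}\mu_1}(x),\qquad Q(y,A)=\frac{{\rm d}\,\mathbb E(W^{(\mu_2)}_\cdot W_A^{(\mu_1)})}{{\rm d}\mu_2}(y).$$ Then, for all $A\in\mathcal F^{\rm fin}(\mu_1)$ and $B\in\mathcal F^{\rm fin}(\mu_2)$, $$\int_AP(x,B)\,\mu_1(dx)=\int_BQ(y,A)\,\mu_2(dy)=\mathbb E(W_A^{(\mu_1)}W_B^{(\mu_2)}).$$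
   Context: For a sigma-finite positive measure $\mu$ on $(X,\mathcal F)$, $\mathcal F^{\rm fin}(\mu)=\{A\in\mathcal F:\mu(A)<\infty\}$. $\mathfrak H(\mu)$ is the reproducing kernel Hilbert space of complex functions on $\mathcal F^{\rm fin}(\mu)$ with kernel $\mu(A\cap B)$; it is known to consist exactly of the functions $M(A)=\int_A h\,d\mu$ with $h\in\mathbf L^2(X,\mathcal F,\mu)$, and $\|M\|=\|h\|_2$. The Krein-Feller derivative $\nabla_\mu:\mathfrak H(\mu)\to\mathbf L^2(X,\mathcal F,\mu)$ sends $M$ to this (unique) $h$; $\nabla_\mu M$ is also written $\frac{{\rm d}M}{{\rm d}\mu}$. Thus $\frac{{\rm d}\,\mathbb E(W^{(\mu_1)}_\cdot W_B^{(\mu_2)})}{{\rm d}\mu_1}$ is $\nabla_{\mu_1}$ applied to $D\mapsto\mathbb E(W^{(\mu_1)}_DW^{(\mu_2)}_B)$, $D\in\mathcal F^{\rm fin}(\mu_1)$, and similarly with the indices exchanged. Universal Hilbert space $\mathfrak H_{(X,\mathcal F)}$: consider pairs $(f,\mu)$ with $\mu$ a sigma-finite positive measure on $(X,\mathcal F)$ and $f\in\mathbf L^2(X,\mathcal F,\mu)$; $(f_1,\mu_1)\sim(f_2,\mu_2)$ if there is a sigma-finite positive measure $\nu$ with $\mu_1\ll\nu$, $\mu_2\ll\nu$ and $f_1\sqrt{d\mu_1/d\nu}=f_2\sqrt{d\mu_2/d\nu}$ $\nu$-a.e. This is an equivalence relation; the class of $(f,\mu)$ is written $f\sqrt\mu$.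 With $\nu$ any common dominating measure, the linear structure is given by $\alpha f_1\sqrt{\mu_1}+\beta f_2\sqrt{\mu_2}=\big(\alpha f_1\sqrt{d\mu_1/d\nu}+\beta f_2\sqrt{d\mu_2/d\nu}\big)\sqrt\nu$ and the inner product by $\langle f_1\sqrt{\mu_1},f_2\sqrt{\mu_2}\rangle=\int_X f_1\overline{f_2}\sqrt{d\mu_1/d\nu}\sqrt{d\mu_2/d\nu}\,d\nu$, so that $\|f\sqrt\mu\|^2=\int_X|f|^2d\mu$; this is a Hilbert space. Universal probability space: fix an orthonormal basis $(e_i)_{i\in I}$ of $\mathfrak H_{(X,\mathcal F)}$ consisting of classes of real-valued functions, let $\Omega=\prod_{i\in I}\mathbb R$ with the cylinder sigma-algebra $\mathcal C$ and $\mathbb P$ the product of standard Gaussian measures, with coordinate functions $Z_i$. For $k\in\mathfrak H_{(X,\mathcal F)}$ put $W(k)=\sum_{i\in I}\langle k,e_i\rangle Z_i\in\mathbf L^2(\Omega,\mathcal C,\mathbb P)$. The $\mu$-Brownian motion is $W^{(\mu)}_A=W(1_A\sqrt\mu)$, $A\in\mathcal F^{\rm fin}(\mu)$ (a real centered Gaussian family with $\mathbb E(W^{(\mu)}_AW^{(\mu)}_B)=\mu(A\cap B)$). *)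

theory Defs
  imports "HOL-Probability.Probability"
begin

text \<open>A measurable space \<open>(X, \<F>)\<close> is given by a term \<open>M :: 'a measure\<close>; only
  \<^term>\<open>space M\<close> and \<^term>\<open>sets M\<close> are used, never the measure carried by \<open>M\<close>.\<close>

definition sigma_finite_measures :: "'a measure \<Rightarrow> 'a measure set" where
  "sigma_finite_measures M = {\<mu>. sets \<mu> = sets M \<and> sigma_finite_measure \<mu>}"

definition fin_sets :: "'a measure \<Rightarrow> 'a set set" where
  "fin_sets \<mu> = {A \<in> sets \<mu>. emeasure \<mu> A < \<infinity>}"

definition L2 :: "'a measure \<Rightarrow> ('a \<Rightarrow> complex) set" where
  "L2 \<mu> = {f \<in> borel_measurable \<mu>. integrable \<mu> (\<lambda>x. (cmod (f x))\<^sup>2)}"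

text \<open>The density \<open>h\<close> is unique only up to \<open>\<mu>\<close>-null sets, so a representative is chosen.\<close>

definition krein_feller :: "'a measure \<Rightarrow> ('a set \<Rightarrow> complex) \<Rightarrow> 'a \<Rightarrow> complex" where
  "krein_feller \<mu> N =
     (SOME h. h \<in> L2 \<mu> \<and> (\<forall>A\<in>fin_sets \<mu>. N A = (LINT x:A|\<mu>. h x)))"

type_synonym 'a uh_vec = "(('a \<Rightarrow> complex) \<times> 'a measure) set"

definition uh_pairs :: "'a measure \<Rightarrow> (('a \<Rightarrow> complex) \<times> 'a measure) set" where
  "uh_pairs M = {(f, \<mu>). \<mu> \<in> sigma_finite_measures M \<and> f \<in> L2 \<mu>}"

text \<open>\<open>f \<surd>(d\<mu>/d\<nu>)\<close>, for \<open>\<mu>\<close> absolutely continuous with respect to \<open>\<nu>\<close>; for sigma-finite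
  \<open>\<mu>\<close> the Radon-Nikodym derivative is finite \<open>\<nu>\<close>-almost everywhere.\<close>

definition uh_density :: "'a measure \<Rightarrow> ('a \<Rightarrow> complex) \<Rightarrow> 'a measure \<Rightarrow> 'a \<Rightarrow> complex" where
  "uh_density \<nu> f \<mu> x = f x * complex_of_real (sqrt (enn2real (RN_deriv \<nu> \<mu> x)))"

text \<open>The library's \<^term>\<open>absolutely_continuous \<nu> \<mu>\<close> means \<open>\<mu> \<lless> \<nu>\<close>.\<close>

definition dominating :: "'a measure \<Rightarrow> 'a measure \<Rightarrow> 'a measure \<Rightarrow> 'a measure set" where
  "dominating M \<mu>1 \<mu>2 = {\<nu> \<in> sigma_finite_measures M.
     absolutely_continuous \<nu> \<mu>1 \<and> absolutely_continuous \<nu> \<mu>2}"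

definition uh_rel ::
  "'a measure \<Rightarrow> ((('a \<Rightarrow> complex) \<times> 'a measure) \<times> (('a \<Rightarrow> complex) \<times> 'a measure)) set" where
  "uh_rel M = {((f1, \<mu>1), (f2, \<mu>2)).
     (f1, \<mu>1) \<in> uh_pairs M \<and> (f2, \<mu>2) \<in> uh_pairs M \<and>
     (\<exists>\<nu>\<in>dominating M \<mu>1 \<mu>2. AE x in \<nu>. uh_density \<nu> f1 \<mu>1 x = uh_density \<nu> f2 \<mu>2 x)}"

definition uh_space :: "'a measure \<Rightarrow> 'a uh_vec set" where
  "uh_space M = uh_pairs M // uh_rel M"

text \<open>The vector \<open>f \<surd>\<mu>\<close>.\<close>

definition uh_class :: "'a measure \<Rightarrow> ('a \<Rightarrow> complex) \<Rightarrow> 'a measure \<Rightarrow> 'a uh_vec" where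
  "uh_class M f \<mu> = uh_rel M `` {(f, \<mu>)}"

text \<open>The linear combination \<open>\<alpha> k1 + \<beta> k2\<close> and the inner product (linear in its first argument)
  do not depend on the representatives nor on the common dominating measure.\<close>

definition uh_lincomb ::
  "'a measure \<Rightarrow> complex \<Rightarrow> 'a uh_vec \<Rightarrow> complex \<Rightarrow> 'a uh_vec \<Rightarrow> 'a uh_vec" where
  "uh_lincomb M \<alpha> k1 \<beta> k2 = (THE k. \<exists>f1 \<mu>1 f2 \<mu>2 \<nu>.
     (f1, \<mu>1) \<in> k1 \<and> (f2, \<mu>2) \<in> k2 \<and> \<nu> \<in> dominating M \<mu>1 \<mu>2 \<and>
     k = uh_class M (\<lambda>x. \<alpha> * uh_density \<nu> f1 \<mu>1 x + \<beta> * uh_density \<nu> f2 \<mu>2 x) \<nu>)"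

definition uh_inner :: "'a measure \<Rightarrow> 'a uh_vec \<Rightarrow> 'a uh_vec \<Rightarrow> complex" where
  "uh_inner M k1 k2 = (THE c. \<exists>f1 \<mu>1 f2 \<mu>2 \<nu>.
     (f1, \<mu>1) \<in> k1 \<and> (f2, \<mu>2) \<in> k2 \<and> \<nu> \<in> dominating M \<mu>1 \<mu>2 \<and>
     c = (LINT x|\<nu>. uh_density \<nu> f1 \<mu>1 x * cnj (uh_density \<nu> f2 \<mu>2 x)))"

definition uh_norm :: "'a measure \<Rightarrow> 'a uh_vec \<Rightarrow> real" where
  "uh_norm M k = sqrt (Re (uh_inner M k k))"

inductive_set uh_span :: "'a measure \<Rightarrow> 'a uh_vec set \<Rightarrow> 'a uh_vec set"
  for M :: "'a measure" and E :: "'a uh_vec set" where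
  zero: "uh_class M (\<lambda>_. 0) (null_measure M) \<in> uh_span M E"
| step: "v \<in> uh_span M E \<Longrightarrow> k \<in> E \<Longrightarrow> uh_lincomb M 1 v c k \<in> uh_span M E"

text \<open>An orthonormal basis (orthonormal family with dense linear span) made of classes of
  real-valued functions.\<close>

definition real_orthonormal_basis :: "'a measure \<Rightarrow> 'i set \<Rightarrow> ('i \<Rightarrow> 'a uh_vec) \<Rightarrow> bool" where
  "real_orthonormal_basis M I e \<longleftrightarrow>
     (\<forall>i\<in>I. e i \<in> uh_space M) \<and>
     (\<forall>i\<in>I. \<exists>f \<mu>. (f, \<mu>) \<in> e i \<and> (\<forall>x\<in>space M. f x \<in> \<real>)) \<and>
     (\<forall>i\<in>I. \<forall>j\<in>I. uh_inner M (e i) (e j) = (if i = j then 1 else 0)) \<and>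
     (\<forall>k\<in>uh_space M. \<forall>\<epsilon>>0. \<exists>v\<in>uh_span M (e ` I). uh_norm M (uh_lincomb M 1 k (-1) v) < \<epsilon>)"

definition univ_prob :: "'i set \<Rightarrow> ('i \<Rightarrow> real) measure" where
  "univ_prob I = (\<Pi>\<^sub>M i\<in>I. density lborel (\<lambda>x. ennreal (std_normal_density x)))"

text \<open>\<open>W(k)\<close> is the sum in \<open>L\<^sup>2\<close> (along the finite subsets of \<open>I\<close>) of \<open>\<langle>k, e\<^sub>i\<rangle> Z\<^sub>i\<close>, where
  \<open>Z\<^sub>i \<omega> = \<omega> i\<close>; it is determined almost surely, and a version is chosen.\<close>

definition W :: "'a measure \<Rightarrow> 'i set \<Rightarrow> ('i \<Rightarrow> 'a uh_vec) \<Rightarrow> 'a uh_vec \<Rightarrow> ('i \<Rightarrow> real) \<Rightarrow> complex" where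
  "W M I e k = (SOME Y. Y \<in> L2 (univ_prob I) \<and>
     ((\<lambda>J. LINT \<omega>|univ_prob I.
         (cmod (Y \<omega> - (\<Sum>i\<in>J. uh_inner M k (e i) * complex_of_real (\<omega> i))))\<^sup>2) \<longlongrightarrow> 0)
       (finite_subsets_at_top I))"

definition brownian ::
  "'a measure \<Rightarrow> 'i set \<Rightarrow> ('i \<Rightarrow> 'a uh_vec) \<Rightarrow> 'a measure \<Rightarrow> 'a set \<Rightarrow> ('i \<Rightarrow> real) \<Rightarrow> complex" where
  "brownian M I e \<mu> A = W M I e (uh_class M (indicator A) \<mu>)"

definition brownian_cov ::
  "'a measure \<Rightarrow> 'i set \<Rightarrow> ('i \<Rightarrow> 'a uh_vec) \<Rightarrow> 'a measure \<Rightarrow> 'a set \<Rightarrow> 'a measure \<Rightarrow> 'a set \<Rightarrow> complex"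
  where
  "brownian_cov M I e \<mu> A \<nu> B =
     (LINT \<omega>|univ_prob I. brownian M I e \<mu> A \<omega> * brownian M I e \<nu> B \<omega>)"

end

theory Submission imports Defs
begin

text \<open>Write \<open>k\<close> for \<open>1\<^sub>B\<surd>\<mu>\<^sub>2\<close>. By Riesz-Fischer the series \<open>W(k)\<close> converges, because
  the coefficients \<open>\<langle>k, e\<^sub>i\<rangle>\<close> are square summable (Bessel), and orthonormality of the
  \<open>Z\<^sub>i\<close> gives \<open>E(W\<^sub>D W\<^sub>B) = \<Sum>\<^sub>i \<langle>1\<^sub>D\<surd>\<mu>\<^sub>1, e\<^sub>i\<rangle> \<langle>k, e\<^sub>i\<rangle>\<close>.
  Only countably many \<open>\<langle>k, e\<^sub>i\<rangle>\<close> are nonzero, so one sigma-finite \<open>\<nu>\<close> dominates \<open>\<mu>\<^sub>1\<close> and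
  all relevant \<open>e\<^sub>i\<close>; summing the conjugates \<open>\<Sum>\<^sub>i \<langle>k, e\<^sub>i\<rangle> e\<^sub>i\<^sup>*\<close> in \<open>L\<^sup>2(\<nu>)\<close> and dividing by
  \<open>\<surd>(d\<mu>\<^sub>1/d\<nu>)\<close> yields an \<open>h \<in> L\<^sup>2(\<mu>\<^sub>1)\<close> with \<open>E(W\<^sub>D W\<^sub>B) = \<integral>\<^sub>D h d\<mu>\<^sub>1\<close> for all \<open>D\<close>.
  So the covariance has a Krein-Feller derivative, whose integral over \<open>A\<close> is the covariance;
  exchanging the two measures gives the other half.\<close>

subsection \<open>Square-integrable functions\<close>

lemma L2_measurable [measurable_dest]: "f \<in> L2 N \<Longrightarrow> f \<in> borel_measurable N"
  by (simp add: L2_def)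

lemma L2_integrable: "f \<in> L2 N \<Longrightarrow> integrable N (\<lambda>x. (cmod (f x))\<^sup>2)"
  by (simp add: L2_def)

lemma L2_mult_integrable:
  assumes "f \<in> L2 N" "g \<in> L2 N"
  shows "integrable N (\<lambda>x. f x * g x)"
proof (rule Bochner_Integration.integrable_bound)
  show "integrable N (\<lambda>x. (cmod (f x))\<^sup>2 + (cmod (g x))\<^sup>2)"
    using assms by (intro Bochner_Integration.integrable_add L2_integrable)
  show "(\<lambda>x. f x * g x) \<in> borel_measurable N"
    using assms by measurable
  have "a * b \<le> a\<^sup>2 + b\<^sup>2" if "a \<ge> 0" "b \<ge> 0" for a b :: real
    using sum_squares_bound[of a b] mult_nonneg_nonneg[OF that] by linarith
  then show "AE x in N. norm (f x * g x) \<le> norm ((cmod (f x))\<^sup>2 + (cmod (g x))\<^sup>2)"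
    by (simp add: norm_mult)
qed

lemma L2_zero: "(\<lambda>_. 0) \<in> L2 N"
  by (simp add: L2_def)

lemma L2_cmult: "f \<in> L2 N \<Longrightarrow> (\<lambda>x. c * f x) \<in> L2 N"
  by (auto simp add: L2_def norm_mult power_mult_distrib)

lemma L2_cnj: "f \<in> L2 N \<Longrightarrow> (\<lambda>x. cnj (f x)) \<in> L2 N"
  by (auto simp add: L2_def intro: measurable_compose[OF _ borel_measurable_continuous_onI[of cnj]]
      continuous_intros)

lemma cmod_add_square_le: "(cmod (a + b))\<^sup>2 \<le> 2 * (cmod a)\<^sup>2 + 2 * (cmod b)\<^sup>2"
proof -
  have "(cmod (a + b))\<^sup>2 \<le> (cmod a + cmod b)\<^sup>2"
    by (intro power_mono norm_triangle_ineq) auto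
  also have "\<dots> \<le> 2 * (cmod a)\<^sup>2 + 2 * (cmod b)\<^sup>2"
    using sum_squares_bound[of "cmod a" "cmod b"] by (simp add: power2_sum)
  finally show ?thesis .
qed

lemma L2_add:
  assumes "f \<in> L2 N" "g \<in> L2 N"
  shows "(\<lambda>x. f x + g x) \<in> L2 N"
proof -
  have "integrable N (\<lambda>x. (cmod (f x + g x))\<^sup>2)"
  proof (rule Bochner_Integration.integrable_bound)
    show "integrable N (\<lambda>x. 2 * (cmod (f x))\<^sup>2 + 2 * (cmod (g x))\<^sup>2)"
      using assms by (intro Bochner_Integration.integrable_add integrable_mult_right L2_integrable)
    show "(\<lambda>x. (cmod (f x + g x))\<^sup>2) \<in> borel_measurable N"
      using assms by measurable
    show "AE x in N. norm ((cmod (f x + g x))\<^sup>2) \<le> norm (2 * (cmod (f x))\<^sup>2 + 2 * (cmod (g x))\<^sup>2)"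
      using cmod_add_square_le by simp
  qed
  with assms show ?thesis by (auto simp add: L2_def)
qed

lemma L2_diff: "f \<in> L2 N \<Longrightarrow> g \<in> L2 N \<Longrightarrow> (\<lambda>x. f x - g x) \<in> L2 N"
  using L2_add[of f N "\<lambda>x. (-1) * g x"] L2_cmult[of g N "-1"] by simp

lemma L2_sum: "(\<And>i. i \<in> J \<Longrightarrow> f i \<in> L2 N) \<Longrightarrow> (\<lambda>x. \<Sum>i\<in>J. f i x) \<in> L2 N"
  by (induction J rule: infinite_finite_induct) (auto intro: L2_zero L2_add)

lemma L2_lincomb: "(\<And>i. i \<in> J \<Longrightarrow> f i \<in> L2 N) \<Longrightarrow> (\<lambda>x. \<Sum>i\<in>J. c i * f i x) \<in> L2 N"
  by (rule L2_sum) (rule L2_cmult)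

lemma integral_L2_norm_eq:
  "complex_of_real (LINT x|N. (cmod (f x))\<^sup>2) = (LINT x|N. f x * cnj (f x))"
  by (simp only: complex_norm_square[symmetric] integral_complex_of_real)

text \<open>Continuity of the bilinear pairing under mean-square convergence along an arbitrary
  filter. A weighted Young inequality takes the place of Cauchy-Schwarz. No conjugate occurs, since
  covariances E(XY) are bilinear.\<close>

lemma L2_pairing_tendsto:
  fixes s :: "'j \<Rightarrow> 'b \<Rightarrow> complex"
  assumes X: "X \<in> L2 N" and Y: "Y \<in> L2 N" and s: "eventually (\<lambda>J. s J \<in> L2 N) F"
    and lim: "((\<lambda>J. LINT x|N. (cmod (Y x - s J x))\<^sup>2) \<longlongrightarrow> 0) F"
  shows "((\<lambda>J. LINT x|N. X x * s J x) \<longlongrightarrow> (LINT x|N. X x * Y x)) F"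
proof (rule tendstoI)
  fix \<epsilon> :: real assume \<epsilon>: "\<epsilon> > 0"
  define a where "a = (LINT x|N. (cmod (X x))\<^sup>2)"
  have a: "a \<ge> 0" unfolding a_def by simp
  \<comment> \<open>The weight satisfies \<open>t * a \<le> \<epsilon>\<close>; the
    \<open>+ 1\<close> keeps the denominator positive when X vanishes almost everywhere. Once the
    mean-square error is below \<open>t * \<epsilon>\<close>, Young's inequality bounds twice the
    distance by \<open>t * a\<close> plus error over t, hence strictly by
    \<open>\<epsilon> + \<epsilon>\<close>.\<close>
  define t where "t = \<epsilon> / (a + 1)"
  have t: "t > 0" "t * a \<le> \<epsilon>" using a \<epsilon> by (auto simp: t_def field_simps)
  have "eventually (\<lambda>J. (LINT x|N. (cmod (Y x - s J x))\<^sup>2) < t * \<epsilon>) F"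
    using order_tendstoD(2)[OF lim] t \<epsilon> by simp
  with s show "eventually (\<lambda>J. dist (LINT x|N. X x * s J x) (LINT x|N. X x * Y x) < \<epsilon>) F"
  proof eventually_elim
    case (elim J)
    note d = L2_diff[OF Y elim(1)]
    have "2 * (u * v) \<le> t * u\<^sup>2 + v\<^sup>2 / t" for u v :: real
    proof -
      have "0 \<le> (t * u - v)\<^sup>2 / t" using t by simp
      also have "\<dots> = t * u\<^sup>2 + v\<^sup>2 / t - 2 * (u * v)"
        using t by (simp add: power2_eq_square field_simps)
      finally show ?thesis by simp
    qed
    then have young: "2 * cmod (X x * (Y x - s J x)) \<le> t * (cmod (X x))\<^sup>2 + (cmod (Y x - s J x))\<^sup>2 / t" for x
      by (simp add: norm_mult)
    have "dist (LINT x|N. X x * s J x) (LINT x|N. X x * Y x) = cmod (LINT x|N. X x * (Y x - s J x))"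
      by (subst dist_commute)
        (simp add: dist_norm right_diff_distrib Bochner_Integration.integral_diff
          L2_mult_integrable X Y elim(1))
    also have "2 * \<dots> \<le> 2 * (LINT x|N. cmod (X x * (Y x - s J x)))"
      by (simp add: integral_norm_bound)
    also have "\<dots> = (LINT x|N. 2 * cmod (X x * (Y x - s J x)))"
      by simp
    also have "\<dots> \<le> (LINT x|N. t * (cmod (X x))\<^sup>2 + (cmod (Y x - s J x))\<^sup>2 / t)"
      using young by (intro integral_mono integrable_mult_right integrable_norm L2_mult_integrable
          Bochner_Integration.integrable_add integrable_divide X d L2_integrable) auto
    also have "\<dots> = t * a + (LINT x|N. (cmod (Y x - s J x))\<^sup>2) / t"
      using L2_integrable[OF X] L2_integrable[OF d]
      by (subst Bochner_Integration.integral_add) (auto simp: a_def)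
    also have "\<dots> < \<epsilon> + \<epsilon>"
      using t elim(2) by (intro add_le_less_mono) (auto simp: field_simps)
    finally show ?case by simp
  qed
qed

section \<open>Finite subfamilies of orthonormal systems and Bessel's inequality\<close>

lemma eventually_finite_subset:
  "eventually (\<lambda>J. finite J \<and> J \<subseteq> A) (finite_subsets_at_top A)"
  by (rule eventually_finite_subsets_at_top_weakI) simp

text \<open>Stated for an arbitrary measure because it serves twice: for the Gaussian coordinates on
  \<open>univ_prob I\<close>, and for densities of basis vectors with respect to a dominating
  measure on X.\<close>

definition L2_orthonormal :: "'b measure \<Rightarrow> 'i set \<Rightarrow> ('i \<Rightarrow> 'b \<Rightarrow> complex) \<Rightarrow> bool" where
  "L2_orthonormal N I \<phi> \<longleftrightarrow> (\<forall>i\<in>I. \<phi> i \<in> L2 N) \<and>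
     (\<forall>i\<in>I. \<forall>j\<in>I. (LINT x|N. \<phi> i x * cnj (\<phi> j x)) = (if i = j then 1 else 0))"

lemma L2_orthonormal_mono: "L2_orthonormal N I \<phi> \<Longrightarrow> J \<subseteq> I \<Longrightarrow> L2_orthonormal N J \<phi>"
  unfolding L2_orthonormal_def by blast

lemma integral_lincomb_mult:
  assumes J: "finite J" and \<phi>: "\<And>i. i \<in> J \<Longrightarrow> \<phi> i \<in> L2 N" and f: "f \<in> L2 N"
  shows "(LINT x|N. (\<Sum>i\<in>J. c i * \<phi> i x) * f x) = (\<Sum>i\<in>J. c i * (LINT x|N. \<phi> i x * f x))"
  using assms L2_mult_integrable[OF \<phi> f]
  by (simp add: sum_distrib_right Bochner_Integration.integral_sum mult.assoc)

lemma L2_orthonormal_coeff: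
  assumes "L2_orthonormal N J \<phi>" "finite J" "j \<in> J"
  shows "(LINT x|N. (\<Sum>i\<in>J. c i * \<phi> i x) * cnj (\<phi> j x)) = c j"
proof -
  have "(LINT x|N. (\<Sum>i\<in>J. c i * \<phi> i x) * cnj (\<phi> j x))
      = (\<Sum>i\<in>J. c i * (LINT x|N. \<phi> i x * cnj (\<phi> j x)))"
    using assms by (intro integral_lincomb_mult L2_cnj) (auto simp: L2_orthonormal_def)
  also have "\<dots> = (\<Sum>i\<in>J. if i = j then c i else 0)"
    using assms(1,3) unfolding L2_orthonormal_def by (intro sum.cong) auto
  finally show ?thesis using assms by simp
qed

text \<open>Pythagoras: only the conjugated factor is expanded, and pairing the whole sum with each
  \<open>\<phi> j\<close> reads off \<open>c j\<close>.\<close>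

lemma L2_orthonormal_norm:
  assumes on: "L2_orthonormal N J \<phi>" and J: "finite J"
  shows "(LINT x|N. (cmod (\<Sum>i\<in>J. c i * \<phi> i x))\<^sup>2) = (\<Sum>i\<in>J. (cmod (c i))\<^sup>2)"
proof -
  let ?s = "\<lambda>x. \<Sum>i\<in>J. c i * \<phi> i x"
  have \<phi>: "\<And>i. i \<in> J \<Longrightarrow> \<phi> i \<in> L2 N" using on by (simp add: L2_orthonormal_def)
  have "complex_of_real (LINT x|N. (cmod (?s x))\<^sup>2) = (LINT x|N. ?s x * cnj (?s x))"
    by (rule integral_L2_norm_eq)
  also have "\<dots> = (LINT x|N. (\<Sum>j\<in>J. cnj (c j) * cnj (\<phi> j x)) * ?s x)"
    by (simp add: mult.commute)
  also have "\<dots> = (\<Sum>j\<in>J. cnj (c j) * (LINT x|N. cnj (\<phi> j x) * ?s x))"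
    using J \<phi> by (intro integral_lincomb_mult L2_cnj L2_lincomb)
  also have "\<dots> = (\<Sum>j\<in>J. cnj (c j) * c j)"
    using L2_orthonormal_coeff[OF on J] by (simp add: mult.commute)
  also have "\<dots> = complex_of_real (\<Sum>i\<in>J. (cmod (c i))\<^sup>2)"
    by (simp add: complex_norm_square mult.commute del: of_real_power)
  finally show ?thesis by (simp only: of_real_eq_iff)
qed

text \<open>Expand the squared norm of \<open>f - s\<close>, which is nonnegative, where s is the
  orthogonal projection of f onto the span of the family. Both the squared norm of s and the real
  part of the inner product of f with s equal the sum of the squared coefficients.\<close>

lemma Bessel_ineq:
  assumes on: "L2_orthonormal N J \<phi>" and J: "finite J" and f: "f \<in> L2 N"
  shows "(\<Sum>i\<in>J. (cmod (LINT x|N. f x * cnj (\<phi> i x)))\<^sup>2) \<le> (LINT x|N. (cmod (f x))\<^sup>2)"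
proof -
  define d where "d i = (LINT x|N. f x * cnj (\<phi> i x))" for i
  define s where "s x = (\<Sum>i\<in>J. d i * \<phi> i x)" for x
  have \<phi>: "\<And>i. i \<in> J \<Longrightarrow> \<phi> i \<in> L2 N" using on by (simp add: L2_orthonormal_def)
  have s: "s \<in> L2 N" unfolding s_def[abs_def] by (intro L2_lincomb \<phi>)
  have sf: "(LINT x|N. f x * cnj (s x)) = (\<Sum>i\<in>J. cnj (d i) * d i)"
  proof -
    have "(LINT x|N. f x * cnj (s x)) = (LINT x|N. (\<Sum>i\<in>J. cnj (d i) * cnj (\<phi> i x)) * f x)"
      by (simp add: s_def mult.commute)
    also have "\<dots> = (\<Sum>i\<in>J. cnj (d i) * (LINT x|N. cnj (\<phi> i x) * f x))"
      using J \<phi> f by (intro integral_lincomb_mult L2_cnj)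
    finally show ?thesis by (simp add: d_def mult.commute)
  qed
  have norm_d: "(\<Sum>i\<in>J. cnj (d i) * d i) = complex_of_real (\<Sum>i\<in>J. (cmod (d i))\<^sup>2)"
    by (simp add: complex_norm_square mult.commute del: of_real_power)
  have fs: "(LINT x|N. Re (f x * cnj (s x))) = (\<Sum>i\<in>J. (cmod (d i))\<^sup>2)"
    using integral_Re[OF L2_mult_integrable[OF f L2_cnj[OF s]]] unfolding sf norm_d by simp
  have ss: "(LINT x|N. (cmod (s x))\<^sup>2) = (\<Sum>i\<in>J. (cmod (d i))\<^sup>2)"
    unfolding s_def by (rule L2_orthonormal_norm[OF on J])
  have "0 \<le> (LINT x|N. (cmod (f x - s x))\<^sup>2)" by simp
  also have "\<dots> = (LINT x|N. (cmod (f x))\<^sup>2 + (cmod (s x))\<^sup>2 - 2 * Re (f x * cnj (s x)))"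
    by (rule Bochner_Integration.integral_cong[OF refl])
      (simp add: cmod_power2 power2_diff algebra_simps)
  also have "\<dots> = (LINT x|N. (cmod (f x))\<^sup>2) + (LINT x|N. (cmod (s x))\<^sup>2)
      - 2 * (LINT x|N. Re (f x * cnj (s x)))"
    using L2_integrable[OF f] L2_integrable[OF s] integrable_Re[OF L2_mult_integrable[OF f L2_cnj[OF s]]]
    by (simp del: times_complex.sel)
  finally show ?thesis unfolding fs ss d_def by simp
qed

text \<open>Riesz-Fischer: a sequence that is Cauchy at a geometric rate converges almost everywhere,
  and Fatou's lemma identifies the pointwise limit as the limit in \<open>L\<^sup>2\<close>.\<close>

lemma L2_complete:
  fixes s :: "nat \<Rightarrow> 'b \<Rightarrow> complex"
  assumes s: "\<And>n. s n \<in> L2 N"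
    and cauchy: "\<And>m n. n \<le> m \<Longrightarrow> (LINT x|N. (cmod (s m x - s n x))\<^sup>2) \<le> (1/4) ^ n"
  obtains Y where "Y \<in> L2 N" "\<And>n. (LINT x|N. (cmod (Y x - s n x))\<^sup>2) \<le> (1/4) ^ n"
proof -
  have [measurable]: "s n \<in> borel_measurable N" for n using s by (rule L2_measurable)
  have nn: "(\<integral>\<^sup>+x. ennreal ((cmod (s m x - s n x))\<^sup>2) \<partial>N) \<le> ennreal ((1/4) ^ n)" if "n \<le> m" for m n
    using nn_integral_eq_integral[OF L2_integrable[OF L2_diff[OF s s]]] cauchy[OF that]
    by (simp add: ennreal_leI)
  \<comment> \<open>The weights \<open>2 ^ n\<close> still leave the convergent series of
    \<open>2 ^ n * (1/4) ^ n\<close>, so the weighted sum is finite almost everywhere; this forces a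
    pointwise geometric decay of the increments.\<close>
  have "(\<integral>\<^sup>+x. (\<Sum>n. ennreal (2 ^ n * (cmod (s (Suc n) x - s n x))\<^sup>2)) \<partial>N)
      = (\<Sum>n. \<integral>\<^sup>+x. ennreal (2 ^ n * (cmod (s (Suc n) x - s n x))\<^sup>2) \<partial>N)"
    by (intro nn_integral_suminf) measurable
  also have "\<dots> \<le> (\<Sum>n. ennreal ((1/2) ^ n))"
  proof (intro suminf_le allI)
    fix n
    have "(\<integral>\<^sup>+x. ennreal (2 ^ n * (cmod (s (Suc n) x - s n x))\<^sup>2) \<partial>N)
        = ennreal (2 ^ n) * (\<integral>\<^sup>+x. ennreal ((cmod (s (Suc n) x - s n x))\<^sup>2) \<partial>N)"
      by (subst nn_integral_cmult[symmetric]) (auto simp: ennreal_mult)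
    also have "\<dots> \<le> ennreal (2 ^ n) * ennreal ((1/4) ^ n)"
      by (intro mult_left_mono nn) auto
    also have "\<dots> = ennreal ((1/2) ^ n)"
      by (subst ennreal_mult[symmetric]) (auto simp: power_mult_distrib[symmetric])
    finally show "(\<integral>\<^sup>+x. ennreal (2 ^ n * (cmod (s (Suc n) x - s n x))\<^sup>2) \<partial>N) \<le> ennreal ((1/2) ^ n)" .
  qed auto
  also have "\<dots> = ennreal (\<Sum>n. (1/2) ^ n)"
    by (intro suminf_ennreal2) (auto intro: summable_geometric)
  also have "\<dots> < \<infinity>" by simp
  finally have "AE x in N. (\<Sum>n. ennreal (2 ^ n * (cmod (s (Suc n) x - s n x))\<^sup>2)) \<noteq> \<infinity>"
    by (intro nn_integral_noteq_infinite) auto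
  then have conv: "AE x in N. convergent (\<lambda>n. s n x)"
  proof eventually_elim
    case (elim x)
    define u where "u n = cmod (s (Suc n) x - s n x)" for n
    have sm: "summable (\<lambda>n. 2 ^ n * (u n)\<^sup>2)"
      using elim by (intro summable_suminf_not_top) (auto simp: u_def)
    then have "(\<lambda>n. 2 ^ n * (u n)\<^sup>2) \<longlonglongrightarrow> 0" by (rule summable_LIMSEQ_zero)
    then have "eventually (\<lambda>n. 2 ^ n * (u n)\<^sup>2 < 1) sequentially"
      by (rule order_tendstoD) simp
    \<comment> \<open>Weighted squares below 1 mean increments of at most
      \<open>sqrt (1/2) ^ n\<close>, so the telescoping series converges by comparison.\<close>
    then have ev: "eventually (\<lambda>n. norm (s (Suc n) x - s n x) \<le> (sqrt (1/2)) ^ n) sequentially"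
    proof eventually_elim
      case (elim n)
      then have "(u n)\<^sup>2 \<le> (1/2) ^ n" by (simp add: field_simps power_one_over)
      then have "u n \<le> sqrt ((1/2) ^ n)" by (rule real_le_rsqrt)
      then show ?case by (simp add: u_def real_sqrt_power)
    qed
    have "summable (\<lambda>n. s (Suc n) x - s n x)"
      by (rule summable_comparison_test_ev[OF ev], rule summable_geometric) (simp add: real_sqrt_divide)
    then have "convergent (\<lambda>n. \<Sum>k<n. s (Suc k) x - s k x)"
      by (simp add: summable_iff_convergent)
    then have "convergent (\<lambda>n. s n x - s 0 x)"
      using sum_lessThan_telescope[of "\<lambda>n. s n x"] by simp
    from convergent_add[OF this convergent_const[of "s 0 x"]] show ?case by simp
  qed
  \<comment> \<open>Where the sequence diverges, \<open>lim\<close> is a fixed unspecified value; Y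
    is therefore defined and measurable everywhere, and that null set does not affect the
    integrals.\<close>
  define Y where "Y x = lim (\<lambda>n. s n x)" for x
  have Ym [measurable]: "Y \<in> borel_measurable N" unfolding Y_def by measurable
  have bound: "(\<integral>\<^sup>+x. ennreal ((cmod (Y x - s n x))\<^sup>2) \<partial>N) \<le> ennreal ((1/4) ^ n)" for n
  proof -
    have "(\<integral>\<^sup>+x. ennreal ((cmod (Y x - s n x))\<^sup>2) \<partial>N)
        = (\<integral>\<^sup>+x. liminf (\<lambda>m. ennreal ((cmod (s m x - s n x))\<^sup>2)) \<partial>N)"
    proof (rule nn_integral_cong_AE, use conv in eventually_elim)
      case (elim x)
      then have "(\<lambda>m. s m x) \<longlonglongrightarrow> Y x" by (simp add: Y_def convergent_LIMSEQ_iff)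
      then have "(\<lambda>m. ennreal ((cmod (s m x - s n x))\<^sup>2)) \<longlonglongrightarrow> ennreal ((cmod (Y x - s n x))\<^sup>2)"
        by (intro tendsto_intros)
      then show ?case by (intro lim_imp_Liminf[symmetric]) auto
    qed
    also have "\<dots> \<le> liminf (\<lambda>m. \<integral>\<^sup>+x. ennreal ((cmod (s m x - s n x))\<^sup>2) \<partial>N)"
      by (intro nn_integral_liminf) measurable
    also have "\<dots> \<le> liminf (\<lambda>m. ennreal ((1/4) ^ n))"
      by (intro Liminf_mono eventually_sequentiallyI[of n] nn)
    finally show ?thesis by (simp add: Liminf_const)
  qed
  have d: "(\<lambda>x. Y x - s n x) \<in> L2 N" for n
    using le_less_trans[OF bound[of n]] by (auto simp: L2_def integrable_iff_bounded)
  show ?thesis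
  proof
    show "Y \<in> L2 N" using L2_add[OF d[of 0] s[of 0]] by simp
    show "(LINT x|N. (cmod (Y x - s n x))\<^sup>2) \<le> (1/4) ^ n" for n
      using bound[of n] nn_integral_eq_integral[OF L2_integrable[OF d]] by simp
  qed
qed

text \<open>The coefficients are square summable, so finite sets can be chosen outside which finite
  sums of their squares are at most \<open>(1/4) ^ n\<close>. Partial sums over an increasing
  sequence of such sets fall under \<open>L2_complete\<close>, and the tail bound shows that the
  limit obtained is also the limit over the net of all finite subsets, whatever the cardinality of
  I.\<close>

lemma Riesz_Fischer:
  assumes on: "L2_orthonormal N I \<phi>"
    and bnd: "\<And>J. finite J \<Longrightarrow> J \<subseteq> I \<Longrightarrow> (\<Sum>i\<in>J. (cmod (c i))\<^sup>2) \<le> K"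
  obtains Y where "Y \<in> L2 N"
    "((\<lambda>J. LINT x|N. (cmod (Y x - (\<Sum>i\<in>J. c i * \<phi> i x)))\<^sup>2) \<longlongrightarrow> 0) (finite_subsets_at_top I)"
proof -
  define q where "q i = (cmod (c i))\<^sup>2" for i
  define S where "S J x = (\<Sum>i\<in>J. c i * \<phi> i x)" for J x
  have S: "S J \<in> L2 N" if "J \<subseteq> I" for J
    using on that unfolding S_def by (intro L2_lincomb) (auto simp: L2_orthonormal_def)
  have "q summable_on I"
  proof (rule nonneg_bdd_above_summable_on)
    show "bdd_above (sum q ` {F. F \<subseteq> I \<and> finite F})"
      unfolding q_def using bnd by (intro bdd_aboveI2[where M=K]) simp
  qed (simp add: q_def)
  then have hs: "(sum q \<longlongrightarrow> infsum q I) (finite_subsets_at_top I)"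
    using has_sum_infsum unfolding has_sum_def by blast
  \<comment> \<open>The sums over \<open>J0\<close> and over \<open>J0 \<union> F\<close> both lie
    within half of \<open>(1/4) ^ n\<close> of the total; their difference is the sum over
    F.\<close>
  have tail: "\<exists>J0. finite J0 \<and> J0 \<subseteq> I \<and> (\<forall>F. finite F \<longrightarrow> F \<subseteq> I - J0 \<longrightarrow> sum q F \<le> (1/4) ^ n)" for n :: nat
  proof -
    have "eventually (\<lambda>J. dist (sum q J) (infsum q I) < (1/4) ^ n / 2) (finite_subsets_at_top I)"
      using hs by (rule tendstoD) simp
    then obtain J0 where J0: "finite J0" "J0 \<subseteq> I"
      and near: "\<forall>J. finite J \<and> J0 \<subseteq> J \<and> J \<subseteq> I \<longrightarrow> dist (sum q J) (infsum q I) < (1/4) ^ n / 2"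
      unfolding eventually_finite_subsets_at_top by (elim exE conjE)
    show ?thesis
    proof (intro exI[of _ J0] conjI J0 allI impI)
      fix F assume F: "finite F" "F \<subseteq> I - J0"
      have "sum q (J0 \<union> F) = sum q J0 + sum q F"
        using F J0 by (intro sum.union_disjoint) auto
      moreover have "dist (sum q (J0 \<union> F)) (infsum q I) < (1/4) ^ n / 2" "dist (sum q J0) (infsum q I) < (1/4) ^ n / 2"
        using F J0 by (intro near[rule_format]; auto)+
      ultimately show "sum q F \<le> (1/4) ^ n" by (auto simp: dist_real_def abs_real_def split: if_splits)
    qed
  qed
  then obtain T where T: "\<And>n. finite (T n)" "\<And>n. T n \<subseteq> I"
    "\<And>n F. finite F \<Longrightarrow> F \<subseteq> I - T n \<Longrightarrow> sum q F \<le> (1/4) ^ n"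
    by metis
  \<comment> \<open>Unions make the sets increasing, as the Cauchy hypothesis of
    \<open>L2_complete\<close> compares a larger partial sum with a smaller one.\<close>
  define V where "V n = (\<Union>k\<le>n. T k)" for n
  have V: "finite (V n)" "V n \<subseteq> I" "T n \<subseteq> V n" for n using T by (auto simp: V_def)
  have V_mono: "V n \<subseteq> V m" if "n \<le> m" for m n using that by (force simp: V_def)
  have diff: "(LINT x|N. (cmod (S J x - S (V n) x))\<^sup>2) \<le> (1/4) ^ n" if "finite J" "J \<subseteq> I" "V n \<subseteq> J" for J n
  proof -
    have "S J x - S (V n) x = (\<Sum>i\<in>J - V n. c i * \<phi> i x)" for x
      using that V by (simp add: S_def sum_diff)
    then have "(LINT x|N. (cmod (S J x - S (V n) x))\<^sup>2) = sum q (J - V n)"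
      using L2_orthonormal_norm[OF L2_orthonormal_mono[OF on], of "J - V n" c] that by (auto simp: q_def)
    also have "\<dots> \<le> (1/4) ^ n" using that V(3)[of n] by (intro T(3)) auto
    finally show ?thesis .
  qed
  obtain Y where Y: "Y \<in> L2 N" "\<And>n. (LINT x|N. (cmod (Y x - S (V n) x))\<^sup>2) \<le> (1/4) ^ n"
  proof (rule L2_complete[of "\<lambda>n. S (V n)" N])
    show "S (V n) \<in> L2 N" for n using V by (intro S)
    show "(LINT x|N. (cmod (S (V m) x - S (V n) x))\<^sup>2) \<le> (1/4) ^ n" if "n \<le> m" for m n
      using V V_mono[OF that] by (intro diff)
  qed blast
  show ?thesis
  proof
    show "Y \<in> L2 N" by fact
    show "((\<lambda>J. LINT x|N. (cmod (Y x - (\<Sum>i\<in>J. c i * \<phi> i x)))\<^sup>2) \<longlongrightarrow> 0) (finite_subsets_at_top I)"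
      unfolding S_def[symmetric]
    proof (rule tendstoI)
      fix \<epsilon> :: real assume "\<epsilon> > 0"
      \<comment> \<open>The factor 4 comes from \<open>cmod_add_square_le\<close>: twice the error
        of Y plus twice the error of \<open>S J\<close>, both measured against
        \<open>S (V n)\<close> and each at most \<open>(1/4) ^ n\<close>.\<close>
      have "(\<lambda>n. 4 * (1/4 :: real) ^ n) \<longlonglongrightarrow> 4 * 0" by (intro tendsto_intros LIMSEQ_realpow_zero) auto
      from order_tendstoD(2)[OF this, of \<epsilon>] \<open>\<epsilon> > 0\<close> obtain n where n: "4 * (1/4 :: real) ^ n < \<epsilon>"
        by (auto simp: eventually_sequentially)
      show "eventually (\<lambda>J. dist (LINT x|N. (cmod (Y x - S J x))\<^sup>2) 0 < \<epsilon>) (finite_subsets_at_top I)"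
        unfolding eventually_finite_subsets_at_top
      proof (intro exI[of _ "V n"] conjI V allI impI)
        fix J assume J: "finite J \<and> V n \<subseteq> J \<and> J \<subseteq> I"
        have a: "(\<lambda>x. Y x - S (V n) x) \<in> L2 N" "(\<lambda>x. S J x - S (V n) x) \<in> L2 N" "(\<lambda>x. Y x - S J x) \<in> L2 N"
          using J Y V by (auto intro!: L2_diff S)
        have "(LINT x|N. (cmod (Y x - S J x))\<^sup>2)
            \<le> (LINT x|N. 2 * (cmod (Y x - S (V n) x))\<^sup>2 + 2 * (cmod (S J x - S (V n) x))\<^sup>2)"
        proof (intro integral_mono Bochner_Integration.integrable_add integrable_mult_right L2_integrable a)
          fix x
          show "(cmod (Y x - S J x))\<^sup>2 \<le> 2 * (cmod (Y x - S (V n) x))\<^sup>2 + 2 * (cmod (S J x - S (V n) x))\<^sup>2"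
            using cmod_add_square_le[of "Y x - S (V n) x" "S (V n) x - S J x"]
            by (simp add: norm_minus_commute)
        qed
        also have "\<dots> = 2 * (LINT x|N. (cmod (Y x - S (V n) x))\<^sup>2) + 2 * (LINT x|N. (cmod (S J x - S (V n) x))\<^sup>2)"
          using L2_integrable[OF a(1)] L2_integrable[OF a(2)] by simp
        also have "\<dots> \<le> 4 * (1/4) ^ n"
          using Y(2)[of n] diff[of J n] J by simp
        also note n
        finally show "dist (LINT x|N. (cmod (Y x - S J x))\<^sup>2) 0 < \<epsilon>" by simp
      qed
    qed
  qed
qed

subsection \<open>Dominating measures and densities\<close>

lemma sigma_finite_measuresD:
  assumes "\<mu> \<in> sigma_finite_measures M"
  shows "sets \<mu> = sets M" "sigma_finite_measure \<mu>" "space \<mu> = space M"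
  using assms sets_eq_imp_space_eq[of \<mu> M] by (auto simp: sigma_finite_measures_def)

text \<open>Each \<open>\<rho> n\<close> has a strictly positive integrable function
  \<open>g n\<close>. The normalised measures \<open>\<kappa> n\<close> with density proportional to
  \<open>g n\<close> have total mass at most 1, so their mixture with positive weights of sum 1 is
  finite. A null set of the mixture is null for every \<open>\<kappa> n\<close>, and then for
  \<open>\<rho> n\<close> because \<open>g n\<close> is positive.\<close>

lemma ex_dominating_sequence:
  fixes \<rho> :: "nat \<Rightarrow> 'a measure"
  assumes \<rho>: "\<And>n. \<rho> n \<in> sigma_finite_measures M"
  obtains \<nu> where "\<nu> \<in> sigma_finite_measures M" "\<And>n. absolutely_continuous \<nu> (\<rho> n)"
proof -
  have [measurable_cong]: "sets (\<rho> n) = sets M" for n using \<rho> by (rule sigma_finite_measuresD)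
  have sp: "space (\<rho> n) = space M" for n using \<rho> by (rule sigma_finite_measuresD)
  have "\<exists>g\<in>borel_measurable (\<rho> n). integral\<^sup>N (\<rho> n) g \<noteq> \<infinity> \<and> (\<forall>x\<in>space (\<rho> n). 0 < g x \<and> g x < \<infinity>)" for n
    using \<rho> by (intro sigma_finite_measure.Ex_finite_integrable_function sigma_finite_measuresD)
  then obtain g where g: "\<And>n. g n \<in> borel_measurable (\<rho> n)" "\<And>n. integral\<^sup>N (\<rho> n) (g n) \<noteq> \<infinity>"
    "\<And>n x. x \<in> space M \<Longrightarrow> 0 < g n x"
    unfolding sp by metis
  have [measurable]: "g n \<in> borel_measurable M" for n using g(1)[of n] by measurable
  \<comment> \<open>Adding 1 keeps the normalising constant nonzero even when
    \<open>\<rho> n\<close> is the zero measure.\<close>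
  define a where "a n = integral\<^sup>N (\<rho> n) (g n) + 1" for n
  have a: "a n \<noteq> \<infinity>" "a n \<noteq> 0" for n using g(2)[of n] by (auto simp: a_def)
  define \<kappa> where "\<kappa> n A = (\<integral>\<^sup>+x. g n x * indicator A x \<partial>\<rho> n) / a n" for n A
  have \<kappa>_le: "\<kappa> n A \<le> 1" for n A
  proof -
    have "(\<integral>\<^sup>+x. g n x * indicator A x \<partial>\<rho> n) \<le> integral\<^sup>N (\<rho> n) (g n)"
      by (intro nn_integral_mono) (auto split: split_indicator)
    also have "\<dots> \<le> a n" by (simp add: a_def)
    finally have "\<kappa> n A \<le> a n / a n" unfolding \<kappa>_def by (rule divide_right_mono_ennreal)
    then show ?thesis using a by (simp add: ennreal_divide_self less_top)
  qed
  \<comment> \<open>The geometric distribution supplies the weights: its support is all of the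
    naturals, so a vanishing mixture makes every \<open>\<kappa> n A\<close> vanish.\<close>
  let ?p = "geometric_pmf (1/2)"
  define \<nu> where "\<nu> = measure_of (space M) (sets M) (\<lambda>A. \<integral>\<^sup>+n. \<kappa> n A \<partial>measure_pmf ?p)"
  have em: "emeasure \<nu> A = (\<integral>\<^sup>+n. \<kappa> n A \<partial>measure_pmf ?p)" if "A \<in> sets M" for A
    unfolding \<nu>_def
  proof (rule emeasure_measure_of_sigma)
    show "sigma_algebra (space M) (sets M)" by (rule sets.sigma_algebra_axioms)
    show "positive (sets M) (\<lambda>A. \<integral>\<^sup>+n. \<kappa> n A \<partial>measure_pmf ?p)"
      by (simp add: positive_def \<kappa>_def)
    show "countably_additive (sets M) (\<lambda>A. \<integral>\<^sup>+n. \<kappa> n A \<partial>measure_pmf ?p)"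
    proof (rule countably_additiveI)
      fix A :: "nat \<Rightarrow> 'a set" assume A: "range A \<subseteq> sets M" "disjoint_family A"
      have [measurable]: "A i \<in> sets M" for i using A by auto
      have "\<kappa> n (\<Union>i. A i) = (\<Sum>i. \<kappa> n (A i))" for n
      proof -
        have "(\<integral>\<^sup>+x. g n x * indicator (\<Union>i. A i) x \<partial>\<rho> n)
            = (\<integral>\<^sup>+x. (\<Sum>i. g n x * indicator (A i) x) \<partial>\<rho> n)"
          by (intro nn_integral_cong) (simp add: suminf_indicator[OF A(2), symmetric])
        also have "\<dots> = (\<Sum>i. \<integral>\<^sup>+x. g n x * indicator (A i) x \<partial>\<rho> n)"
          by (intro nn_integral_suminf) measurable
        finally show ?thesis by (simp add: \<kappa>_def divide_ennreal_def)
      qed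
      then show "(\<Sum>i. \<integral>\<^sup>+n. \<kappa> n (A i) \<partial>measure_pmf ?p) = (\<integral>\<^sup>+n. \<kappa> n (\<Union>i. A i) \<partial>measure_pmf ?p)"
        by (simp add: nn_integral_suminf)
    qed
  qed fact
  have sets: "sets \<nu> = sets M" "space \<nu> = space M" by (auto simp: \<nu>_def)
  show ?thesis
  proof
    have "emeasure \<nu> (space \<nu>) \<le> (\<integral>\<^sup>+n. 1 \<partial>measure_pmf ?p)"
      unfolding sets by (subst em) (intro nn_integral_mono \<kappa>_le sets.top)+
    then have "finite_measure \<nu>" by (intro finite_measureI) (auto simp: top_unique)
    then show "\<nu> \<in> sigma_finite_measures M"
      by (auto simp: sigma_finite_measures_def sets finite_measure_def)
    show "absolutely_continuous \<nu> (\<rho> n)" for n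
      unfolding absolutely_continuous_def
    proof
      fix A assume "A \<in> null_sets \<nu>"
      then have A [measurable]: "A \<in> sets M" and "(\<integral>\<^sup>+n. \<kappa> n A \<partial>measure_pmf ?p) = 0"
        by (auto simp: null_sets_def sets em)
      then have "\<kappa> n A = 0" by (simp add: nn_integral_0_iff_AE AE_measure_pmf_iff set_pmf_geometric)
      then have "(\<integral>\<^sup>+x. g n x * indicator A x \<partial>\<rho> n) = 0"
        using a by (simp add: \<kappa>_def)
      then have "AE x in \<rho> n. g n x * indicator A x = 0"
        by (subst (asm) nn_integral_0_iff_AE) measurable
      then have "AE x in \<rho> n. x \<notin> A"
        using AE_space
      proof eventually_elim
        case (elim x) then show ?case using g(3)[of x n] by (auto simp: sp)
      qed
      then show "A \<in> null_sets (\<rho> n)" using A by (subst (asm) AE_iff_null_sets[symmetric]) auto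
    qed
  qed
qed

lemma ex_dominating:
  assumes "countable N" "N \<subseteq> sigma_finite_measures M"
  obtains \<nu> where "\<nu> \<in> sigma_finite_measures M" "\<And>\<mu>. \<mu> \<in> N \<Longrightarrow> absolutely_continuous \<nu> \<mu>"
proof (cases "N = {}")
  case True
  \<comment> \<open>The empty family cannot be enumerated by \<open>from_nat_into\<close>; any
    sigma-finite measure will do here.\<close>
  have "sigma_finite_measure (null_measure M)"
    by (auto intro!: finite_measure.axioms(1) finite_measureI)
  then show ?thesis using that[of "null_measure M"] True by (auto simp: sigma_finite_measures_def)
next
  case False
  with assms have N: "range (from_nat_into N) = N" by (intro range_from_nat_into)
  obtain \<nu> where "\<nu> \<in> sigma_finite_measures M" "\<And>n. absolutely_continuous \<nu> (from_nat_into N n)"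
    using ex_dominating_sequence[of "from_nat_into N" M] assms False from_nat_into[of N] by blast
  then show ?thesis using that N by (metis rangeE)
qed

lemma ex_dominating_pair:
  assumes "\<mu>1 \<in> sigma_finite_measures M" "\<mu>2 \<in> sigma_finite_measures M"
  shows "\<exists>\<nu>\<in>sigma_finite_measures M. absolutely_continuous \<nu> \<mu>1 \<and> absolutely_continuous \<nu> \<mu>2"
  by (rule ex_dominating[of "{\<mu>1, \<mu>2}" M]) (use assms in auto)

section \<open>Real-valued Radon-Nikodym derivatives and change of measure\<close>

definition rn :: "'a measure \<Rightarrow> 'a measure \<Rightarrow> 'a \<Rightarrow> real" where
  "rn \<nu> \<mu> x = enn2real (RN_deriv \<nu> \<mu> x)"

lemma rn_measurable [measurable]: "rn \<nu> \<mu> \<in> borel_measurable \<nu>"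
  unfolding rn_def[abs_def] by measurable

lemma rn_nonneg [simp]: "rn \<nu> \<mu> x \<ge> 0"
  by (simp add: rn_def)

lemma uh_density_eq: "uh_density \<nu> f \<mu> x = f x * complex_of_real (sqrt (rn \<nu> \<mu> x))"
  by (simp add: uh_density_def rn_def)

context
  fixes M \<mu> \<nu> :: "'a measure"
  assumes \<mu>: "\<mu> \<in> sigma_finite_measures M" and \<nu>: "\<nu> \<in> sigma_finite_measures M"
    and ac: "absolutely_continuous \<nu> \<mu>"
begin

text \<open>Sigma-finiteness of \<open>\<mu>\<close> makes the derivative finite
  \<open>\<nu>\<close>-almost everywhere, so replacing infinite values by 0 does not change the
  measure it defines.\<close>

lemma density_rn: "density \<nu> (\<lambda>x. ennreal (rn \<nu> \<mu> x)) = \<mu>"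
proof -
  interpret \<nu>: sigma_finite_measure \<nu> using \<nu> by (rule sigma_finite_measuresD)
  have sets: "sets \<mu> = sets \<nu>" using \<mu> \<nu> by (simp add: sigma_finite_measuresD)
  have "AE x in \<nu>. RN_deriv \<nu> \<mu> x \<noteq> \<infinity>"
    using sigma_finite_measuresD(2)[OF \<mu>] ac sets by (rule \<nu>.RN_deriv_finite)
  then have "density \<nu> (\<lambda>x. ennreal (rn \<nu> \<mu> x)) = density \<nu> (RN_deriv \<nu> \<mu>)"
    by (intro density_cong) (auto simp: rn_def less_top[symmetric])
  also have "\<dots> = \<mu>" by (rule \<nu>.density_RN_deriv[OF ac sets])
  finally show ?thesis .
qed

lemma rn_unique:
  assumes [measurable]: "g \<in> borel_measurable \<nu>" and "\<And>x. g x \<ge> 0"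
    and "density \<nu> (\<lambda>x. ennreal (g x)) = \<mu>"
  shows "AE x in \<nu>. g x = rn \<nu> \<mu> x"
proof -
  interpret \<nu>: sigma_finite_measure \<nu> using \<nu> by (rule sigma_finite_measuresD)
  have "AE x in \<nu>. ennreal (g x) = RN_deriv \<nu> \<mu> x"
    using assms by (intro \<nu>.RN_deriv_unique) auto
  then show ?thesis by eventually_elim (metis assms(2) enn2real_ennreal rn_def)
qed

lemma measurable_change:
  fixes f :: "'a \<Rightarrow> 'b::topological_space"
  shows "f \<in> borel_measurable \<mu> \<longleftrightarrow> f \<in> borel_measurable \<nu>"
  using sigma_finite_measuresD[OF \<mu>] sigma_finite_measuresD[OF \<nu>] by (simp cong: measurable_cong_sets)

lemma integral_change:
  fixes f :: "'a \<Rightarrow> 'b::{banach, second_countable_topology}"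
  assumes "f \<in> borel_measurable \<mu>"
  shows "(LINT x|\<mu>. f x) = (LINT x|\<nu>. rn \<nu> \<mu> x *\<^sub>R f x)"
proof -
  have [measurable]: "f \<in> borel_measurable \<nu>" using assms by (simp only: measurable_change)
  have "(LINT x|density \<nu> (\<lambda>x. ennreal (rn \<nu> \<mu> x)). f x) = (LINT x|\<nu>. rn \<nu> \<mu> x *\<^sub>R f x)"
    by (rule integral_density) auto
  then show ?thesis by (simp add: density_rn)
qed

lemma integrable_change:
  fixes f :: "'a \<Rightarrow> 'b::{banach, second_countable_topology}"
  assumes "f \<in> borel_measurable \<mu>"
  shows "integrable \<mu> f \<longleftrightarrow> integrable \<nu> (\<lambda>x. rn \<nu> \<mu> x *\<^sub>R f x)"
proof -
  have [measurable]: "f \<in> borel_measurable \<nu>" using assms by (simp only: measurable_change)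
  have "integrable (density \<nu> (\<lambda>x. ennreal (rn \<nu> \<mu> x))) f \<longleftrightarrow> integrable \<nu> (\<lambda>x. rn \<nu> \<mu> x *\<^sub>R f x)"
    by (rule integrable_density) auto
  then show ?thesis by (simp add: density_rn)
qed

lemma AE_change: "(AE x in \<mu>. P x) \<longleftrightarrow> (AE x in \<nu>. 0 < rn \<nu> \<mu> x \<longrightarrow> P x)"
  using AE_density[of "\<lambda>x. ennreal (rn \<nu> \<mu> x)" \<nu> P] unfolding density_rn by simp

text \<open>The square root is squared back into the density of \<open>\<mu>\<close>: the squared
  modulus of \<open>uh_density \<nu> f \<mu>\<close> is \<open>rn \<nu> \<mu>\<close> times that of
  f.\<close>

lemma uh_density_L2:
  assumes "f \<in> L2 \<mu>"
  shows "uh_density \<nu> f \<mu> \<in> L2 \<nu>"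
proof -
  have [measurable]: "f \<in> borel_measurable \<nu>" "f \<in> borel_measurable \<mu>"
    using L2_measurable[OF assms] measurable_change by auto
  have "integrable \<nu> (\<lambda>x. rn \<nu> \<mu> x *\<^sub>R (cmod (f x))\<^sup>2)"
    using L2_integrable[OF assms] by (subst (asm) integrable_change) auto
  then show ?thesis
    unfolding L2_def uh_density_eq[abs_def] by (simp add: norm_mult power_mult_distrib mult.commute)
qed

end

lemma absolutely_continuous_trans:
  "absolutely_continuous \<xi> \<nu> \<Longrightarrow> absolutely_continuous \<nu> \<mu> \<Longrightarrow> absolutely_continuous \<xi> \<mu>"
  by (auto simp: absolutely_continuous_def)

text \<open>The chain rule for Radon-Nikodym derivatives, which follows from their uniqueness, under
  a square root.\<close>

lemma uh_density_chain:
  assumes \<mu>: "\<mu> \<in> sigma_finite_measures M" and \<nu>: "\<nu> \<in> sigma_finite_measures M"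
    and \<xi>: "\<xi> \<in> sigma_finite_measures M"
    and ac: "absolutely_continuous \<xi> \<nu>" "absolutely_continuous \<nu> \<mu>"
  shows "AE x in \<xi>. uh_density \<xi> f \<mu> x = uh_density \<nu> f \<mu> x * complex_of_real (sqrt (rn \<xi> \<nu> x))"
proof -
  have ac': "absolutely_continuous \<xi> \<mu>" using ac by (rule absolutely_continuous_trans)
  have [measurable]: "rn \<nu> \<mu> \<in> borel_measurable \<xi>"
    using measurable_change[OF \<nu> \<xi> ac(1), of "rn \<nu> \<mu>"] by simp
  have "density \<xi> (\<lambda>x. ennreal (rn \<xi> \<nu> x * rn \<nu> \<mu> x))
      = density (density \<xi> (\<lambda>x. ennreal (rn \<xi> \<nu> x))) (\<lambda>x. ennreal (rn \<nu> \<mu> x))"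
    by (subst density_density_eq) (auto simp: ennreal_mult)
  also have "\<dots> = \<mu>"
    by (simp add: density_rn[OF \<nu> \<xi> ac(1)] density_rn[OF \<mu> \<nu> ac(2)])
  finally have "AE x in \<xi>. rn \<xi> \<nu> x * rn \<nu> \<mu> x = rn \<xi> \<mu> x"
    by (intro rn_unique[OF \<mu> \<xi> ac']) auto
  then show ?thesis
  proof eventually_elim
    case (elim x)
    show ?case unfolding uh_density_eq elim[symmetric] by (simp add: real_sqrt_mult)
  qed
qed

subsection \<open>The inner product\<close>

lemma uh_pairsD: "(f, \<mu>) \<in> uh_pairs M \<Longrightarrow> \<mu> \<in> sigma_finite_measures M \<and> f \<in> L2 \<mu>"
  by (simp add: uh_pairs_def)

text \<open>The relation provides equality for one dominating \<open>\<nu>\<close> only. It is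
  carried to \<open>\<xi>\<close> through a measure \<open>\<kappa>\<close> dominating both: up to
  \<open>\<kappa>\<close> by multiplying with the square root of the derivative of
  \<open>\<nu>\<close>, and down to \<open>\<xi>\<close> by cancelling that of \<open>\<xi>\<close>
  where it is positive, which is all that \<open>\<xi>\<close> sees.\<close>

lemma uh_relD:
  assumes rel: "((f1, \<mu>1), (f2, \<mu>2)) \<in> uh_rel M" and \<xi>: "\<xi> \<in> dominating M \<mu>1 \<mu>2"
  shows "AE x in \<xi>. uh_density \<xi> f1 \<mu>1 x = uh_density \<xi> f2 \<mu>2 x"
proof -
  obtain \<nu> where \<nu>: "\<nu> \<in> dominating M \<mu>1 \<mu>2"
    and eq: "AE x in \<nu>. uh_density \<nu> f1 \<mu>1 x = uh_density \<nu> f2 \<mu>2 x"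
    and \<mu>: "\<mu>1 \<in> sigma_finite_measures M" "\<mu>2 \<in> sigma_finite_measures M"
    using rel by (auto simp: uh_rel_def uh_pairs_def)
  have sf: "\<nu> \<in> sigma_finite_measures M" "\<xi> \<in> sigma_finite_measures M"
    using \<nu> \<xi> by (auto simp: dominating_def)
  have ac: "absolutely_continuous \<nu> \<mu>1" "absolutely_continuous \<nu> \<mu>2"
    "absolutely_continuous \<xi> \<mu>1" "absolutely_continuous \<xi> \<mu>2"
    using \<nu> \<xi> by (auto simp: dominating_def)
  obtain \<kappa> where \<kappa>: "\<kappa> \<in> sigma_finite_measures M" "absolutely_continuous \<kappa> \<nu>" "absolutely_continuous \<kappa> \<xi>"
    using ex_dominating_pair[OF sf] by metis
  have "AE x in \<kappa>. 0 < rn \<kappa> \<nu> x \<longrightarrow> uh_density \<nu> f1 \<mu>1 x = uh_density \<nu> f2 \<mu>2 x"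
    using eq unfolding AE_change[OF sf(1) \<kappa>(1,2)] .
  moreover note uh_density_chain[OF \<mu>(1) sf(1) \<kappa>(1,2) ac(1), of f1]
    uh_density_chain[OF \<mu>(2) sf(1) \<kappa>(1,2) ac(2), of f2]
    uh_density_chain[OF \<mu>(1) sf(2) \<kappa>(1,3) ac(3), of f1]
    uh_density_chain[OF \<mu>(2) sf(2) \<kappa>(1,3) ac(4), of f2]
  ultimately have "AE x in \<kappa>. 0 < rn \<kappa> \<xi> x \<longrightarrow> uh_density \<xi> f1 \<mu>1 x = uh_density \<xi> f2 \<mu>2 x"
  proof eventually_elim
    case (elim x)
    show ?case
    proof
      assume pos: "0 < rn \<kappa> \<xi> x"
      \<comment> \<open>Where \<open>rn \<kappa> \<nu> x\<close> is 0 the two densities may differ,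
        but both products vanish.\<close>
      have "uh_density \<nu> f1 \<mu>1 x * complex_of_real (sqrt (rn \<kappa> \<nu> x))
          = uh_density \<nu> f2 \<mu>2 x * complex_of_real (sqrt (rn \<kappa> \<nu> x))"
        using elim(1) rn_nonneg[of \<kappa> \<nu> x] by (cases "rn \<kappa> \<nu> x = 0") auto
      then have "uh_density \<xi> f1 \<mu>1 x * complex_of_real (sqrt (rn \<kappa> \<xi> x))
          = uh_density \<xi> f2 \<mu>2 x * complex_of_real (sqrt (rn \<kappa> \<xi> x))"
        using elim by metis
      then show "uh_density \<xi> f1 \<mu>1 x = uh_density \<xi> f2 \<mu>2 x" using pos by simp
    qed
  qed
  then show ?thesis unfolding AE_change[OF sf(2) \<kappa>(1,3)] .
qed

lemma uh_rel_refl: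
  assumes "(f, \<mu>) \<in> uh_pairs M"
  shows "((f, \<mu>), (f, \<mu>)) \<in> uh_rel M"
  using assms by (auto simp: uh_rel_def uh_pairs_def dominating_def absolutely_continuous_def)

text \<open>By the chain rule each factor gains \<open>sqrt (rn \<xi> \<nu> x)\<close>; together the
  two give exactly the density needed to pass from \<open>\<nu>\<close> to
  \<open>\<xi>\<close>.\<close>

lemma uh_inner_integral_change:
  assumes 1: "(f1, \<mu>1) \<in> uh_pairs M" and 2: "(f2, \<mu>2) \<in> uh_pairs M"
    and \<nu>: "\<nu> \<in> dominating M \<mu>1 \<mu>2" and \<xi>: "\<xi> \<in> sigma_finite_measures M"
    and ac: "absolutely_continuous \<xi> \<nu>"
  shows "(LINT x|\<nu>. uh_density \<nu> f1 \<mu>1 x * cnj (uh_density \<nu> f2 \<mu>2 x))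
       = (LINT x|\<xi>. uh_density \<xi> f1 \<mu>1 x * cnj (uh_density \<xi> f2 \<mu>2 x))"
proof -
  have \<nu>': "\<nu> \<in> sigma_finite_measures M" "absolutely_continuous \<nu> \<mu>1" "absolutely_continuous \<nu> \<mu>2"
    using \<nu> by (auto simp: dominating_def)
  note \<mu> = uh_pairsD[OF 1, THEN conjunct1] uh_pairsD[OF 2, THEN conjunct1]
  have L: "uh_density \<nu> f1 \<mu>1 \<in> L2 \<nu>" "(\<lambda>x. cnj (uh_density \<nu> f2 \<mu>2 x)) \<in> L2 \<nu>"
    "uh_density \<xi> f1 \<mu>1 \<in> L2 \<xi>" "(\<lambda>x. cnj (uh_density \<xi> f2 \<mu>2 x)) \<in> L2 \<xi>"
    using uh_density_L2[OF \<mu>(1) \<nu>'(1,2), of f1] uh_density_L2[OF \<mu>(2) \<nu>'(1,3), of f2]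
      uh_density_L2[OF \<mu>(1) \<xi> absolutely_continuous_trans[OF ac \<nu>'(2)], of f1]
      uh_density_L2[OF \<mu>(2) \<xi> absolutely_continuous_trans[OF ac \<nu>'(3)], of f2]
      uh_pairsD[OF 1] uh_pairsD[OF 2]
    by (auto intro: L2_cnj)
  have m: "(\<lambda>x. uh_density \<nu> f1 \<mu>1 x * cnj (uh_density \<nu> f2 \<mu>2 x)) \<in> borel_measurable \<nu>"
    using L2_mult_integrable[OF L(1,2)] by auto
  have "(LINT x|\<nu>. uh_density \<nu> f1 \<mu>1 x * cnj (uh_density \<nu> f2 \<mu>2 x))
      = (LINT x|\<xi>. rn \<xi> \<nu> x *\<^sub>R (uh_density \<nu> f1 \<mu>1 x * cnj (uh_density \<nu> f2 \<mu>2 x)))"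
    by (rule integral_change[OF \<nu>'(1) \<xi> ac m])
  also have "\<dots> = (LINT x|\<xi>. uh_density \<xi> f1 \<mu>1 x * cnj (uh_density \<xi> f2 \<mu>2 x))"
  proof (rule integral_cong_AE)
    show "(\<lambda>x. rn \<xi> \<nu> x *\<^sub>R (uh_density \<nu> f1 \<mu>1 x * cnj (uh_density \<nu> f2 \<mu>2 x))) \<in> borel_measurable \<xi>"
      using m unfolding measurable_change[OF \<nu>'(1) \<xi> ac] by measurable
    show "(\<lambda>x. uh_density \<xi> f1 \<mu>1 x * cnj (uh_density \<xi> f2 \<mu>2 x)) \<in> borel_measurable \<xi>"
      using L2_mult_integrable[OF L(3,4)] by auto
    show "AE x in \<xi>. rn \<xi> \<nu> x *\<^sub>R (uh_density \<nu> f1 \<mu>1 x * cnj (uh_density \<nu> f2 \<mu>2 x))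
        = uh_density \<xi> f1 \<mu>1 x * cnj (uh_density \<xi> f2 \<mu>2 x)"
      using uh_density_chain[OF \<mu>(1) \<nu>'(1) \<xi> ac \<nu>'(2), of f1] uh_density_chain[OF \<mu>(2) \<nu>'(1) \<xi> ac \<nu>'(3), of f2]
    proof eventually_elim
      case (elim x)
      have "complex_of_real (rn \<xi> \<nu> x) = complex_of_real (sqrt (rn \<xi> \<nu> x)) * complex_of_real (sqrt (rn \<xi> \<nu> x))"
        by (simp flip: of_real_mult)
      then show ?case unfolding elim by (simp add: scaleR_conv_of_real)
    qed
  qed
  finally show ?thesis .
qed

text \<open>This is the well-definedness behind the definite description in \<open>uh_inner\<close>.
  Two choices of representatives and dominating measures are compared on a measure
  \<open>\<xi>\<close> dominating everything involved, where equivalent representatives have almost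
  everywhere equal densities.\<close>

lemma uh_inner_class:
  assumes 1: "(f1, \<mu>1) \<in> uh_pairs M" and 2: "(f2, \<mu>2) \<in> uh_pairs M" and \<nu>: "\<nu> \<in> dominating M \<mu>1 \<mu>2"
  shows "uh_inner M (uh_class M f1 \<mu>1) (uh_class M f2 \<mu>2)
       = (LINT x|\<nu>. uh_density \<nu> f1 \<mu>1 x * cnj (uh_density \<nu> f2 \<mu>2 x))"
  unfolding uh_inner_def
proof (rule the_equality)
  show "\<exists>f1' \<mu>1' f2' \<mu>2' \<nu>'. (f1', \<mu>1') \<in> uh_class M f1 \<mu>1 \<and> (f2', \<mu>2') \<in> uh_class M f2 \<mu>2 \<and>
      \<nu>' \<in> dominating M \<mu>1' \<mu>2' \<and> (LINT x|\<nu>. uh_density \<nu> f1 \<mu>1 x * cnj (uh_density \<nu> f2 \<mu>2 x))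
        = (LINT x|\<nu>'. uh_density \<nu>' f1' \<mu>1' x * cnj (uh_density \<nu>' f2' \<mu>2' x))"
    using uh_rel_refl[OF 1] uh_rel_refl[OF 2] \<nu> unfolding uh_class_def by blast
next
  fix c
  assume "\<exists>f1' \<mu>1' f2' \<mu>2' \<nu>'. (f1', \<mu>1') \<in> uh_class M f1 \<mu>1 \<and> (f2', \<mu>2') \<in> uh_class M f2 \<mu>2 \<and>
      \<nu>' \<in> dominating M \<mu>1' \<mu>2' \<and> c = (LINT x|\<nu>'. uh_density \<nu>' f1' \<mu>1' x * cnj (uh_density \<nu>' f2' \<mu>2' x))"
  then obtain f1' \<mu>1' f2' \<mu>2' \<nu>' where rel: "((f1, \<mu>1), (f1', \<mu>1')) \<in> uh_rel M" "((f2, \<mu>2), (f2', \<mu>2')) \<in> uh_rel M"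
    and \<nu>': "\<nu>' \<in> dominating M \<mu>1' \<mu>2'"
    and c: "c = (LINT x|\<nu>'. uh_density \<nu>' f1' \<mu>1' x * cnj (uh_density \<nu>' f2' \<mu>2' x))"
    unfolding uh_class_def by blast
  have r1: "(f1', \<mu>1') \<in> uh_pairs M" and r2: "(f2', \<mu>2') \<in> uh_pairs M"
    using rel by (auto simp: uh_rel_def)
  have sf: "\<nu> \<in> sigma_finite_measures M" "\<nu>' \<in> sigma_finite_measures M"
    using \<nu> \<nu>' by (auto simp: dominating_def)
  obtain \<xi> where \<xi>: "\<xi> \<in> sigma_finite_measures M" "absolutely_continuous \<xi> \<nu>" "absolutely_continuous \<xi> \<nu>'"
    using ex_dominating_pair[OF sf] by metis
  have ac: "absolutely_continuous \<xi> \<mu>1" "absolutely_continuous \<xi> \<mu>2"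
    "absolutely_continuous \<xi> \<mu>1'" "absolutely_continuous \<xi> \<mu>2'"
    using \<nu> \<nu>' absolutely_continuous_trans[OF \<xi>(2)] absolutely_continuous_trans[OF \<xi>(3)]
    by (auto simp: dominating_def)
  have "c = (LINT x|\<xi>. uh_density \<xi> f1' \<mu>1' x * cnj (uh_density \<xi> f2' \<mu>2' x))"
    unfolding c by (rule uh_inner_integral_change[OF r1 r2 \<nu>' \<xi>(1,3)])
  also have "\<dots> = (LINT x|\<xi>. uh_density \<xi> f1 \<mu>1 x * cnj (uh_density \<xi> f2 \<mu>2 x))"
  proof (rule integral_cong_AE)
    have "\<xi> \<in> dominating M \<mu>1 \<mu>1'" "\<xi> \<in> dominating M \<mu>2 \<mu>2'"
      using \<xi> ac by (auto simp: dominating_def)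
    then have "AE x in \<xi>. uh_density \<xi> f1 \<mu>1 x = uh_density \<xi> f1' \<mu>1' x"
      "AE x in \<xi>. uh_density \<xi> f2 \<mu>2 x = uh_density \<xi> f2' \<mu>2' x"
      using rel by (blast intro: uh_relD)+
    then show "AE x in \<xi>. uh_density \<xi> f1' \<mu>1' x * cnj (uh_density \<xi> f2' \<mu>2' x)
        = uh_density \<xi> f1 \<mu>1 x * cnj (uh_density \<xi> f2 \<mu>2 x)"
      by eventually_elim simp
  qed (intro borel_measurable_integrable L2_mult_integrable L2_cnj uh_density_L2[OF _ \<xi>(1)] ac;
       use 1 2 r1 r2 in \<open>auto simp: uh_pairs_def\<close>)+
  also have "\<dots> = (LINT x|\<nu>. uh_density \<nu> f1 \<mu>1 x * cnj (uh_density \<nu> f2 \<mu>2 x))"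
    by (rule uh_inner_integral_change[OF 1 2 \<nu> \<xi>(1,2), symmetric])
  finally show "c = (LINT x|\<nu>. uh_density \<nu> f1 \<mu>1 x * cnj (uh_density \<nu> f2 \<mu>2 x))" .
qed

subsection \<open>The Gaussian coordinates and Brownian covariances\<close>

text \<open>Each coordinate is standard normal, which gives second moment 1; distinct coordinates
  are independent with mean 0, which gives orthogonality.\<close>

lemma univ_prob_orthonormal: "L2_orthonormal (univ_prob I) I (\<lambda>i \<omega>. complex_of_real (\<omega> i))"
proof -
  define G where "G = density lborel (\<lambda>x. ennreal (std_normal_density x))"
  have U: "univ_prob I = (\<Pi>\<^sub>M i\<in>I. G)" by (simp add: univ_prob_def G_def)
  have G: "prob_space G" unfolding G_def by (rule prob_space_normal_density) simp
  interpret P: product_prob_space "\<lambda>_. G" I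
    using G by (auto simp: product_prob_space_def product_prob_space_axioms_def product_sigma_finite_def
        prob_space_imp_sigma_finite)
  have [measurable_cong]: "sets G = sets borel" by (simp add: G_def)
  have mom: "integrable G (\<lambda>x. x ^ k)" "(LINT x|G. x ^ k) = (LINT x|lborel. std_normal_density x * x ^ k)" for k
    unfolding G_def using integrable_std_normal_moment[of k]
    by (simp_all add: integrable_density integral_density normal_density_nonneg)
  have G1: "(LINT x|G. x) = 0"
    using mom(2)[of 1] integral_std_normal_moment_odd[of 0] by simp
  have G2: "(LINT x|G. x\<^sup>2) = 1"
    using mom(2)[of 2] integral_std_normal_moment_even[of 1] by simp
  have comp: "distr (univ_prob I) G (\<lambda>\<omega>. \<omega> i) = G" if "i \<in> I" for i
    unfolding U using that by (rule P.PiM_component)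
  have meas: "(\<lambda>\<omega>. \<omega> i) \<in> measurable (univ_prob I) G" if "i \<in> I" for i
    unfolding U using that by measurable
  have sq: "integrable (univ_prob I) (\<lambda>\<omega>. (\<omega> i)\<^sup>2)" "(LINT \<omega>|univ_prob I. (\<omega> i)\<^sup>2) = 1" if "i \<in> I" for i
  proof -
    have m: "(\<lambda>x. x\<^sup>2) \<in> borel_measurable G" by measurable
    have "integrable (distr (univ_prob I) G (\<lambda>\<omega>. \<omega> i)) (\<lambda>x. x\<^sup>2)"
      unfolding comp[OF that] by (rule mom)
    then show "integrable (univ_prob I) (\<lambda>\<omega>. (\<omega> i)\<^sup>2)"
      by (simp add: integrable_distr_eq[OF meas[OF that] m])
    show "(LINT \<omega>|univ_prob I. (\<omega> i)\<^sup>2) = 1"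
      using integral_distr[OF meas[OF that] m] G2 unfolding comp[OF that] by simp
  qed
  have mult: "(LINT \<omega>|univ_prob I. \<omega> i * \<omega> j) = 0" if "i \<in> I" "j \<in> I" "i \<noteq> j" for i j
  proof -
    let ?J = "{i, j}"
    \<comment> \<open>The product involves only two coordinates, so the integral is moved to a
      finite product measure, where Fubini factorises it.\<close>
    have r: "(\<lambda>\<omega>. restrict \<omega> ?J) \<in> measurable (Pi\<^sub>M I (\<lambda>_. G)) (Pi\<^sub>M ?J (\<lambda>_. G))"
      using that by (intro measurable_restrict_subset) auto
    have m: "(\<lambda>\<omega>. \<Prod>k\<in>?J. \<omega> k) \<in> borel_measurable (Pi\<^sub>M ?J (\<lambda>_. G))"
      by measurable
    have "(LINT \<omega>|univ_prob I. \<omega> i * \<omega> j) = (LINT \<omega>|Pi\<^sub>M I (\<lambda>_. G). (\<Prod>k\<in>?J. restrict \<omega> ?J k))"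
      unfolding U using that by simp
    also have "\<dots> = (LINT \<omega>|distr (Pi\<^sub>M I (\<lambda>_. G)) (Pi\<^sub>M ?J (\<lambda>_. G)) (\<lambda>\<omega>. restrict \<omega> ?J). (\<Prod>k\<in>?J. \<omega> k))"
      by (rule integral_distr[OF r m, symmetric])
    also have "\<dots> = (LINT \<omega>|Pi\<^sub>M ?J (\<lambda>_. G). (\<Prod>k\<in>?J. \<omega> k))"
      using that by (subst P.distr_PiM_restrict_finite) auto
    also have "\<dots> = (\<Prod>k\<in>?J. (LINT x|G. x))"
      using mom(1)[of 1] by (intro P.product_integral_prod) auto
    also have "\<dots> = 0" using that by (simp add: G1)
    finally show ?thesis .
  qed
  show ?thesis
    unfolding L2_orthonormal_def
  proof (intro conjI ballI)
    fix i assume i: "i \<in> I"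
    have "(\<lambda>x. x) \<in> borel_measurable G" by measurable
    from measurable_compose[OF meas[OF i] this]
    have [measurable]: "(\<lambda>\<omega>. \<omega> i) \<in> borel_measurable (univ_prob I)" .
    show "(\<lambda>\<omega>. complex_of_real (\<omega> i)) \<in> L2 (univ_prob I)"
      using sq[OF i] by (auto simp: L2_def)
    fix j assume j: "j \<in> I"
    have "(LINT \<omega>|univ_prob I. \<omega> i * \<omega> j) = (if i = j then 1 else 0)"
      using sq(2)[OF i] mult[OF i j] by (cases "i = j") (auto simp: power2_eq_square)
    then have "(LINT \<omega>|univ_prob I. complex_of_real (\<omega> i * \<omega> j)) = (if i = j then 1 else 0)"
      by (simp only: integral_complex_of_real) simp
    then show "(LINT \<omega>|univ_prob I. complex_of_real (\<omega> i) * cnj (complex_of_real (\<omega> j))) = (if i = j then 1 else 0)"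
      by simp
  qed
qed

lemma indicator_L2:
  assumes "A \<in> fin_sets \<mu>"
  shows "indicator A \<in> L2 \<mu>"
proof -
  have A: "A \<in> sets \<mu>" "emeasure \<mu> A < \<infinity>" using assms by (auto simp: fin_sets_def)
  have "(cmod (indicator A x))\<^sup>2 = (indicator A x :: real)" for x
    by (simp split: split_indicator)
  then show ?thesis using A by (simp add: L2_def)
qed

section \<open>Orthonormal families in the universal space and the series W\<close>

definition uh_orthonormal :: "'a measure \<Rightarrow> 'i set \<Rightarrow> ('i \<Rightarrow> 'a uh_vec) \<Rightarrow> bool" where
  "uh_orthonormal M I e \<longleftrightarrow> (\<forall>i\<in>I. e i \<in> uh_space M) \<and>
     (\<forall>i\<in>I. \<forall>j\<in>I. uh_inner M (e i) (e j) = (if i = j then 1 else 0))"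

lemma uh_spaceE:
  assumes "k \<in> uh_space M"
  obtains f \<mu> where "(f, \<mu>) \<in> uh_pairs M" "k = uh_class M f \<mu>"
  using assms unfolding uh_space_def uh_class_def quotient_def by auto

context
  fixes M :: "'a measure" and I :: "'i set" and e :: "'i \<Rightarrow> 'a uh_vec"
    and F :: "'i \<Rightarrow> 'a \<Rightarrow> complex" and R :: "'i \<Rightarrow> 'a measure"
  assumes on: "uh_orthonormal M I e"
    and F: "\<And>i. i \<in> I \<Longrightarrow> (F i, R i) \<in> uh_pairs M"
    and e: "\<And>i. i \<in> I \<Longrightarrow> e i = uh_class M (F i) (R i)"
begin

text \<open>Restricted to index sets J whose measures share a dominating \<open>\<nu>\<close>, since
  an uncountable family of sigma-finite measures may have none.\<close>

lemma uh_densities_orthonormal: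
  assumes \<nu>: "\<nu> \<in> sigma_finite_measures M" and J: "J \<subseteq> I"
    and ac: "\<And>i. i \<in> J \<Longrightarrow> absolutely_continuous \<nu> (R i)"
  shows "L2_orthonormal \<nu> J (\<lambda>i. uh_density \<nu> (F i) (R i))"
  unfolding L2_orthonormal_def
proof (intro conjI ballI)
  fix i assume i: "i \<in> J"
  show "uh_density \<nu> (F i) (R i) \<in> L2 \<nu>"
    using uh_pairsD[OF F] i J ac by (intro uh_density_L2[OF _ \<nu>]) auto
  fix j assume j: "j \<in> J"
  have ij: "i \<in> I" "j \<in> I" using i j J by auto
  have "\<nu> \<in> dominating M (R i) (R j)" using \<nu> ac i j by (simp add: dominating_def)
  from uh_inner_class[OF F[OF ij(1)] F[OF ij(2)] this]
  show "(LINT x|\<nu>. uh_density \<nu> (F i) (R i) x * cnj (uh_density \<nu> (F j) (R j) x)) = (if i = j then 1 else 0)"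
    using on ij unfolding e[OF ij(1), symmetric] e[OF ij(2), symmetric] uh_orthonormal_def by simp
qed

text \<open>Finitely many measures have a common dominating \<open>\<nu>\<close>, so the inequality
  is the one in L2 of \<open>\<nu>\<close>; passing from f to its density preserves the
  norm.\<close>

lemma uh_Bessel:
  assumes f: "(f, \<mu>) \<in> uh_pairs M" and J: "finite J" "J \<subseteq> I"
  shows "(\<Sum>i\<in>J. (cmod (uh_inner M (uh_class M f \<mu>) (e i)))\<^sup>2) \<le> (LINT x|\<mu>. (cmod (f x))\<^sup>2)"
proof -
  have \<mu>: "\<mu> \<in> sigma_finite_measures M" "f \<in> L2 \<mu>" using uh_pairsD[OF f] by auto
  obtain \<nu> where \<nu>: "\<nu> \<in> sigma_finite_measures M"
    and ac: "\<And>\<rho>. \<rho> \<in> insert \<mu> (R ` J) \<Longrightarrow> absolutely_continuous \<nu> \<rho>"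
  proof (rule ex_dominating)
    show "countable (insert \<mu> (R ` J))" using J by (simp add: countable_finite)
    show "insert \<mu> (R ` J) \<subseteq> sigma_finite_measures M"
      using \<mu> uh_pairsD[OF F] J by auto
  qed blast
  have inner: "uh_inner M (uh_class M f \<mu>) (e i)
      = (LINT x|\<nu>. uh_density \<nu> f \<mu> x * cnj (uh_density \<nu> (F i) (R i) x))" if "i \<in> J" for i
  proof -
    have i: "i \<in> I" using that J by auto
    show ?thesis unfolding e[OF i]
      using that \<nu> ac by (intro uh_inner_class[OF f F[OF i]]) (auto simp: dominating_def)
  qed
  have "(\<Sum>i\<in>J. (cmod (uh_inner M (uh_class M f \<mu>) (e i)))\<^sup>2)
      \<le> (LINT x|\<nu>. (cmod (uh_density \<nu> f \<mu> x))\<^sup>2)"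
  proof -
    have "L2_orthonormal \<nu> J (\<lambda>i. uh_density \<nu> (F i) (R i))"
      using \<nu> J ac by (intro uh_densities_orthonormal) auto
    from Bessel_ineq[OF this J(1) uh_density_L2[OF \<mu>(1) \<nu> _ \<mu>(2)]] show ?thesis
      using ac by (simp add: inner)
  qed
  also have "\<dots> = (LINT x|\<mu>. (cmod (f x))\<^sup>2)"
  proof -
    have [measurable]: "f \<in> borel_measurable \<mu>" using \<mu>(2) by (rule L2_measurable)
    show ?thesis
      using ac \<nu> by (subst integral_change[OF \<mu>(1), of \<nu>])
        (auto simp: uh_density_eq norm_mult power_mult_distrib mult.commute)
  qed
  finally show ?thesis .
qed

text \<open>Bessel's inequality and Riesz-Fischer supply some limit of the series, so the choice in
  the definition of \<open>W\<close> really picks one.\<close>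

lemma W_L2_limit:
  assumes f: "(f, \<mu>) \<in> uh_pairs M"
  defines "k \<equiv> uh_class M f \<mu>"
  shows "W M I e k \<in> L2 (univ_prob I)"
    and "((\<lambda>J. LINT \<omega>|univ_prob I.
         (cmod (W M I e k \<omega> - (\<Sum>i\<in>J. uh_inner M k (e i) * complex_of_real (\<omega> i))))\<^sup>2) \<longlongrightarrow> 0)
       (finite_subsets_at_top I)"
proof -
  have "\<exists>Y. Y \<in> L2 (univ_prob I) \<and>
     ((\<lambda>J. LINT \<omega>|univ_prob I.
         (cmod (Y \<omega> - (\<Sum>i\<in>J. uh_inner M k (e i) * complex_of_real (\<omega> i))))\<^sup>2) \<longlongrightarrow> 0)
       (finite_subsets_at_top I)"
  proof (rule Riesz_Fischer[OF univ_prob_orthonormal, of I "\<lambda>i. uh_inner M k (e i)"])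
    show "(\<Sum>i\<in>J. (cmod (uh_inner M k (e i)))\<^sup>2) \<le> (LINT x|\<mu>. (cmod (f x))\<^sup>2)"
      if "finite J" "J \<subseteq> I" for J
      unfolding k_def using that by (rule uh_Bessel[OF f])
  qed blast
  from someI_ex[OF this, folded W_def]
  show "W M I e k \<in> L2 (univ_prob I)"
    and "((\<lambda>J. LINT \<omega>|univ_prob I.
         (cmod (W M I e k \<omega> - (\<Sum>i\<in>J. uh_inner M k (e i) * complex_of_real (\<omega> i))))\<^sup>2) \<longlongrightarrow> 0)
       (finite_subsets_at_top I)"
    by blast+
qed

text \<open>Every partial sum whose index set contains j already pairs with the coordinate j to the
  coefficient, so the convergent pairings are eventually constant.\<close>

lemma W_coeff:
  assumes f: "(f, \<mu>) \<in> uh_pairs M" and j: "j \<in> I"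
  shows "(LINT \<omega>|univ_prob I. complex_of_real (\<omega> j) * W M I e (uh_class M f \<mu>) \<omega>)
    = uh_inner M (uh_class M f \<mu>) (e j)"
proof -
  let ?c = "\<lambda>i. uh_inner M (uh_class M f \<mu>) (e i)"
  let ?s = "\<lambda>J \<omega>. \<Sum>i\<in>J. ?c i * complex_of_real (\<omega> i)"
  note Z = univ_prob_orthonormal[of I]
  have Zj: "(\<lambda>\<omega>. complex_of_real (\<omega> i)) \<in> L2 (univ_prob I)" if "i \<in> I" for i
    using Z that by (simp add: L2_orthonormal_def)
  have "eventually (\<lambda>J. ?s J \<in> L2 (univ_prob I)) (finite_subsets_at_top I)"
    using eventually_finite_subset by eventually_elim (intro L2_lincomb Zj, auto)
  then have lim: "((\<lambda>J. LINT \<omega>|univ_prob I. complex_of_real (\<omega> j) * ?s J \<omega>) \<longlongrightarrow>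
      (LINT \<omega>|univ_prob I. complex_of_real (\<omega> j) * W M I e (uh_class M f \<mu>) \<omega>)) (finite_subsets_at_top I)"
    by (intro L2_pairing_tendsto Zj j W_L2_limit f)
  have "eventually (\<lambda>J. (LINT \<omega>|univ_prob I. complex_of_real (\<omega> j) * ?s J \<omega>) = ?c j) (finite_subsets_at_top I)"
    unfolding eventually_finite_subsets_at_top
  proof (intro exI[of _ "{j}"] conjI allI impI)
    fix J assume J: "finite J \<and> {j} \<subseteq> J \<and> J \<subseteq> I"
    have "(LINT \<omega>|univ_prob I. ?s J \<omega> * cnj (complex_of_real (\<omega> j))) = ?c j"
      using J by (intro L2_orthonormal_coeff[OF L2_orthonormal_mono[OF Z]]) auto
    then show "(LINT \<omega>|univ_prob I. complex_of_real (\<omega> j) * ?s J \<omega>) = ?c j"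
      by (simp add: mult.commute)
  qed (use j in auto)
  with lim show ?thesis
    using tendsto_unique[OF finite_subsets_at_top_neq_bot lim tendsto_eventually] by blast
qed

text \<open>Only the second factor is expanded; pairing it termwise with the first yields
  coefficients by \<open>W_coeff\<close>. The product carries no conjugate, in contrast to
  Parseval's identity for the inner product.\<close>

lemma W_cov_has_sum:
  assumes f: "(f, \<mu>) \<in> uh_pairs M" and g: "(g, \<rho>) \<in> uh_pairs M"
  shows "((\<lambda>i. uh_inner M (uh_class M g \<rho>) (e i) * uh_inner M (uh_class M f \<mu>) (e i)) has_sum
    (LINT \<omega>|univ_prob I. W M I e (uh_class M f \<mu>) \<omega> * W M I e (uh_class M g \<rho>) \<omega>)) I"
proof -
  let ?c = "\<lambda>i. uh_inner M (uh_class M g \<rho>) (e i)"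
  let ?s = "\<lambda>J \<omega>. \<Sum>i\<in>J. ?c i * complex_of_real (\<omega> i)"
  have Z: "(\<lambda>\<omega>. complex_of_real (\<omega> i)) \<in> L2 (univ_prob I)" if "i \<in> I" for i
    using univ_prob_orthonormal[of I] that by (simp add: L2_orthonormal_def)
  have "eventually (\<lambda>J. ?s J \<in> L2 (univ_prob I)) (finite_subsets_at_top I)"
    using eventually_finite_subset by eventually_elim (intro L2_lincomb Z, auto)
  then have lim: "((\<lambda>J. LINT \<omega>|univ_prob I. W M I e (uh_class M f \<mu>) \<omega> * ?s J \<omega>) \<longlongrightarrow>
      (LINT \<omega>|univ_prob I. W M I e (uh_class M f \<mu>) \<omega> * W M I e (uh_class M g \<rho>) \<omega>)) (finite_subsets_at_top I)"
    by (intro L2_pairing_tendsto W_L2_limit f g)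
  have "eventually (\<lambda>J. (LINT \<omega>|univ_prob I. W M I e (uh_class M f \<mu>) \<omega> * ?s J \<omega>)
      = (\<Sum>i\<in>J. ?c i * uh_inner M (uh_class M f \<mu>) (e i))) (finite_subsets_at_top I)"
    using eventually_finite_subset
  proof eventually_elim
    case (elim J)
    have "(LINT \<omega>|univ_prob I. ?s J \<omega> * W M I e (uh_class M f \<mu>) \<omega>)
      = (\<Sum>i\<in>J. ?c i * (LINT \<omega>|univ_prob I. complex_of_real (\<omega> i) * W M I e (uh_class M f \<mu>) \<omega>))"
      using elim by (intro integral_lincomb_mult W_L2_limit f Z) auto
    also have "\<dots> = (\<Sum>i\<in>J. ?c i * uh_inner M (uh_class M f \<mu>) (e i))"
      using elim by (intro sum.cong refl arg_cong2[where f="(*)"] W_coeff f) auto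
    finally show ?case by (simp add: mult.commute)
  qed
  from Lim_transform_eventually[OF lim this] show ?thesis
    by (simp add: has_sum_def)
qed

text \<open>In the witness \<open>h\<close>, division by zero yields zero where \<open>d\<mu>/d\<nu>\<close> vanishes.\<close>

lemma ex_W_cov_density:
  assumes g: "(g, \<rho>) \<in> uh_pairs M" and \<mu>: "\<mu> \<in> sigma_finite_measures M"
  shows "\<exists>h\<in>L2 \<mu>. \<forall>D\<in>fin_sets \<mu>.
    (LINT \<omega>|univ_prob I. W M I e (uh_class M (indicator D) \<mu>) \<omega> * W M I e (uh_class M g \<rho>) \<omega>)
      = (LINT x:D|\<mu>. h x)"
proof -
  define c where "c i = uh_inner M (uh_class M g \<rho>) (e i)" for i
  \<comment> \<open>Square summability makes S countable, so one sigma-finite \<open>\<nu>\<close>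
    can dominate \<open>\<mu>\<close> together with all \<open>R i\<close> for i in S, even when I
    is uncountable.\<close>
  define S where "S = {i \<in> I. c i \<noteq> 0}"
  have bnd: "(\<Sum>i\<in>J. (cmod (c i))\<^sup>2) \<le> (LINT x|\<rho>. (cmod (g x))\<^sup>2)" if "finite J" "J \<subseteq> I" for J
    unfolding c_def using that by (rule uh_Bessel[OF g])
  have "(\<lambda>i. (cmod (c i))\<^sup>2) summable_on I"
  proof (rule nonneg_bdd_above_summable_on)
    show "bdd_above (sum (\<lambda>i. (cmod (c i))\<^sup>2) ` {J. J \<subseteq> I \<and> finite J})"
      using bnd by (intro bdd_aboveI2[where M="LINT x|\<rho>. (cmod (g x))\<^sup>2"]) simp
  qed simp
  from summable_countable_real[OF this] have S: "countable S" by (simp add: S_def)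
  have SI: "S \<subseteq> I" by (auto simp: S_def)
  obtain \<nu> where \<nu>: "\<nu> \<in> sigma_finite_measures M"
    and ac: "\<And>\<tau>. \<tau> \<in> insert \<mu> (R ` S) \<Longrightarrow> absolutely_continuous \<nu> \<tau>"
  proof (rule ex_dominating)
    show "countable (insert \<mu> (R ` S))" using S by simp
    show "insert \<mu> (R ` S) \<subseteq> sigma_finite_measures M"
      using \<mu> uh_pairsD[OF F] SI by auto
  qed blast
  have ac\<mu>: "absolutely_continuous \<nu> \<mu>" using ac by simp
  define \<phi> where "\<phi> i x = uh_density \<nu> (F i) (R i) x" for i x
  have "L2_orthonormal \<nu> S \<phi>"
    unfolding \<phi>_def using \<nu> SI ac by (intro uh_densities_orthonormal) auto
  \<comment> \<open>Conjugation swaps the two arguments of an inner product and preserves the values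
    0 and 1. The conjugated family is the right one because the coefficient \<open>b i\<close> is
    the integral of d against the conjugate of \<open>\<phi> i\<close>, so the sum of all
    \<open>c i * b i\<close> is the integral of d times the series G.\<close>
  then have \<phi>: "L2_orthonormal \<nu> S (\<lambda>i x. cnj (\<phi> i x))"
    unfolding L2_orthonormal_def by (auto simp: L2_cnj mult.commute)
  have \<phi>L2: "(\<lambda>x. cnj (\<phi> i x)) \<in> L2 \<nu>" if "i \<in> S" for i
    using \<phi> that by (simp add: L2_orthonormal_def)
  obtain G where G: "G \<in> L2 \<nu>"
    and lim: "((\<lambda>J. LINT x|\<nu>. (cmod (G x - (\<Sum>i\<in>J. c i * cnj (\<phi> i x))))\<^sup>2) \<longlongrightarrow> 0) (finite_subsets_at_top S)"
  proof (rule Riesz_Fischer[OF \<phi>])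
    show "(\<Sum>i\<in>J. (cmod (c i))\<^sup>2) \<le> (LINT x|\<rho>. (cmod (g x))\<^sup>2)" if "finite J" "J \<subseteq> S" for J
      using that SI by (intro bnd) auto
  qed blast
  define r where "r = rn \<nu> \<mu>"
  define h where "h x = G x / complex_of_real (sqrt (r x))" for x
  have [measurable]: "G \<in> borel_measurable \<nu>" "r \<in> borel_measurable \<nu>"
    using G unfolding r_def by (auto simp: L2_measurable)
  have r0: "r x \<ge> 0" for x by (simp add: r_def)
  have h\<nu> [measurable]: "h \<in> borel_measurable \<nu>" unfolding h_def[abs_def] by measurable
  have h\<mu> [measurable]: "h \<in> borel_measurable \<mu>" using h\<nu> unfolding measurable_change[OF \<mu> \<nu> ac\<mu>] .
  \<comment> \<open>The factor r cancels the squared denominator of h where it is positive, so the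
    integrand is bounded by the squared modulus of G.\<close>
  have "integrable \<nu> (\<lambda>x. r x *\<^sub>R (cmod (h x))\<^sup>2)"
  proof (rule Bochner_Integration.integrable_bound[OF L2_integrable[OF G]])
    show "AE x in \<nu>. norm (r x *\<^sub>R (cmod (h x))\<^sup>2) \<le> norm ((cmod (G x))\<^sup>2)"
      using r0 by (intro AE_I2) (simp add: h_def norm_divide power_divide)
  qed measurable
  then have hL2: "h \<in> L2 \<mu>"
    using integrable_change[OF \<mu> \<nu> ac\<mu>, of "\<lambda>x. (cmod (h x))\<^sup>2"] by (simp add: L2_def r_def)
  show ?thesis
  proof (intro bexI[of _ h] hL2 ballI)
    fix D assume D: "D \<in> fin_sets \<mu>"
    have DM [measurable]: "D \<in> sets \<mu>" "D \<in> sets \<nu>"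
      using D sigma_finite_measuresD(1)[OF \<mu>] sigma_finite_measuresD(1)[OF \<nu>] by (auto simp: fin_sets_def)
    have D2: "indicator D \<in> L2 \<mu>"
      using D by (rule indicator_L2)
    then have Dp: "(indicator D, \<mu>) \<in> uh_pairs M" using \<mu> by (simp add: uh_pairs_def)
    define d where "d x = uh_density \<nu> (indicator D) \<mu> x" for x
    have d: "d \<in> L2 \<nu>" unfolding d_def by (rule uh_density_L2[OF \<mu> \<nu> ac\<mu> D2])
    define b where "b i = uh_inner M (uh_class M (indicator D) \<mu>) (e i)" for i
    have b: "b i = (LINT x|\<nu>. cnj (\<phi> i x) * d x)" if "i \<in> S" for i
    proof -
      have i: "i \<in> I" using that SI by auto
      have "\<nu> \<in> dominating M \<mu> (R i)" using that \<nu> ac by (simp add: dominating_def)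
      from uh_inner_class[OF Dp F[OF i] this] show ?thesis
        unfolding b_def e[OF i] d_def \<phi>_def by (simp add: mult.commute)
    qed
    have "eventually (\<lambda>J. (\<lambda>x. \<Sum>i\<in>J. c i * cnj (\<phi> i x)) \<in> L2 \<nu>) (finite_subsets_at_top S)"
      using eventually_finite_subset by eventually_elim (intro L2_lincomb \<phi>L2, auto)
    note L2_pairing_tendsto[OF d G this lim]
    moreover have "eventually (\<lambda>J. (LINT x|\<nu>. d x * (\<Sum>i\<in>J. c i * cnj (\<phi> i x)))
        = (\<Sum>i\<in>J. c i * b i)) (finite_subsets_at_top S)"
      using eventually_finite_subset
    proof eventually_elim
      case (elim J)
      have "(LINT x|\<nu>. (\<Sum>i\<in>J. c i * cnj (\<phi> i x)) * d x) = (\<Sum>i\<in>J. c i * (LINT x|\<nu>. cnj (\<phi> i x) * d x))"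
        using elim by (intro integral_lincomb_mult d \<phi>L2) auto
      also have "\<dots> = (\<Sum>i\<in>J. c i * b i)"
        using elim b by (intro sum.cong) auto
      finally show ?case by (simp add: mult.commute)
    qed
    ultimately have "((\<lambda>i. c i * b i) has_sum (LINT x|\<nu>. d x * G x)) S"
      unfolding has_sum_def by (rule Lim_transform_eventually)
    \<comment> \<open>Outside S the coefficient \<open>c i\<close> is 0, so the sum over S is also
      the sum over I.\<close>
    then have "((\<lambda>i. c i * b i) has_sum (LINT x|\<nu>. d x * G x)) I"
      by (subst (asm) has_sum_cong_neutral[of I S _ "\<lambda>i. c i * b i"]) (use SI in \<open>auto simp: S_def\<close>)
    moreover have "((\<lambda>i. c i * b i) has_sum
        (LINT \<omega>|univ_prob I. W M I e (uh_class M (indicator D) \<mu>) \<omega> * W M I e (uh_class M g \<rho>) \<omega>)) I"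
      unfolding c_def b_def by (rule W_cov_has_sum[OF Dp g])
    moreover have "(LINT x:D|\<mu>. h x) = (LINT x|\<nu>. d x * G x)"
    proof -
      have "(LINT x:D|\<mu>. h x) = (LINT x|\<nu>. r x *\<^sub>R (indicator D x *\<^sub>R h x))"
        unfolding set_lebesgue_integral_def r_def by (rule integral_change[OF \<mu> \<nu> ac\<mu>]) measurable
      also have "\<dots> = (LINT x|\<nu>. d x * G x)"
      proof (rule Bochner_Integration.integral_cong[OF refl])
        fix x
        \<comment> \<open>The identity \<open>r / sqrt r = sqrt r\<close> also holds at 0, so no
          positivity set has to be split off.\<close>
        have "complex_of_real (r x) * (G x / complex_of_real (sqrt (r x)))
            = complex_of_real (r x / sqrt (r x)) * G x" by simp
        also have "\<dots> = complex_of_real (sqrt (r x)) * G x"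
          using real_div_sqrt[OF r0[of x]] by simp
        finally show "r x *\<^sub>R (indicator D x *\<^sub>R h x) = d x * G x"
          unfolding d_def uh_density_eq r_def[symmetric] h_def scaleR_conv_of_real
          by (simp split: split_indicator)
      qed
      finally show ?thesis .
    qed
    ultimately show "(LINT \<omega>|univ_prob I. W M I e (uh_class M (indicator D) \<mu>) \<omega> * W M I e (uh_class M g \<rho>) \<omega>)
        = (LINT x:D|\<mu>. h x)"
      using has_sum_unique by metis
  qed
qed

end

section \<open>Krein-Feller derivatives of Brownian covariances\<close>

text \<open>With B fixed, \<open>ex_W_cov_density\<close> produces a density for the covariance as a
  function of D, so the representative chosen by \<open>krein_feller\<close> has the defining
  property, which is then read at \<open>D = A\<close>.\<close>

lemma krein_feller_brownian_cov:
  assumes onb: "real_orthonormal_basis M I e"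
    and \<mu>: "\<mu> \<in> sigma_finite_measures M" and \<rho>: "\<rho> \<in> sigma_finite_measures M"
    and A: "A \<in> fin_sets \<mu>" and B: "B \<in> fin_sets \<rho>"
  shows "(LINT x:A|\<mu>. krein_feller \<mu> (\<lambda>D. brownian_cov M I e \<mu> D \<rho> B) x) = brownian_cov M I e \<mu> A \<rho> B"
proof -
  have on: "uh_orthonormal M I e"
    using onb unfolding real_orthonormal_basis_def uh_orthonormal_def by blast
  have "\<exists>f \<mu>. (f, \<mu>) \<in> uh_pairs M \<and> e i = uh_class M f \<mu>" if "i \<in> I" for i
    using on that unfolding uh_orthonormal_def by (metis uh_spaceE)
  then obtain F R where FR: "\<And>i. i \<in> I \<Longrightarrow> (F i, R i) \<in> uh_pairs M" "\<And>i. i \<in> I \<Longrightarrow> e i = uh_class M (F i) (R i)"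
    by metis
  have "indicator B \<in> L2 \<rho>"
    using B by (rule indicator_L2)
  then have "(indicator B, \<rho>) \<in> uh_pairs M" using \<rho> by (simp add: uh_pairs_def)
  from ex_W_cov_density[OF on FR this \<mu>]
  have "\<exists>h. h \<in> L2 \<mu> \<and> (\<forall>D\<in>fin_sets \<mu>. brownian_cov M I e \<mu> D \<rho> B = (LINT x:D|\<mu>. h x))"
    unfolding brownian_cov_def brownian_def by blast
  from someI_ex[OF this, folded krein_feller_def] A show ?thesis by simp
qed

lemma brownian_cov_commute: "brownian_cov M I e \<mu> A \<rho> B = brownian_cov M I e \<rho> B \<mu> A"
  by (simp add: brownian_cov_def mult.commute)

theorem theorem5p7:
  fixes M \<mu>1 \<mu>2 :: "'a measure"
    and I :: "'i set" and e :: "'i \<Rightarrow> 'a uh_vec"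
    and P Q :: "'a \<Rightarrow> 'a set \<Rightarrow> complex"
  assumes "\<mu>1 \<in> sigma_finite_measures M" and "\<mu>2 \<in> sigma_finite_measures M"
    and "real_orthonormal_basis M I e"
    and P: "\<And>x B. B \<in> fin_sets \<mu>2 \<Longrightarrow>
          P x B = krein_feller \<mu>1 (\<lambda>D. brownian_cov M I e \<mu>1 D \<mu>2 B) x"
    and Q: "\<And>y A. A \<in> fin_sets \<mu>1 \<Longrightarrow>
          Q y A = krein_feller \<mu>2 (\<lambda>D. brownian_cov M I e \<mu>2 D \<mu>1 A) y"
  shows "\<forall>A\<in>fin_sets \<mu>1. \<forall>B\<in>fin_sets \<mu>2.
     (LINT x:A|\<mu>1. P x B) = (LINT y:B|\<mu>2. Q y A) \<and>
     (LINT y:B|\<mu>2. Q y A) = brownian_cov M I e \<mu>1 A \<mu>2 B"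
proof (intro ballI)
  fix A B assume A: "A \<in> fin_sets \<mu>1" and B: "B \<in> fin_sets \<mu>2"
  have "(LINT x:A|\<mu>1. P x B) = brownian_cov M I e \<mu>1 A \<mu>2 B"
    unfolding P[OF B] using assms A B by (intro krein_feller_brownian_cov)
  \<comment> \<open>Symmetry of the covariance puts \<open>\<mu>2\<close> first, and the same lemma
    applies with A fixed and B as the domain of integration.\<close>
  moreover have "(LINT y:B|\<mu>2. Q y A) = brownian_cov M I e \<mu>1 A \<mu>2 B"
    unfolding Q[OF A] brownian_cov_commute[of M I e \<mu>1 A]
    using assms A B by (intro krein_feller_brownian_cov)
  ultimately show "(LINT x:A|\<mu>1. P x B) = (LINT y:B|\<mu>2. Q y A) \<and>
     (LINT y:B|\<mu>2. Q y A) = brownian_cov M I e \<mu>1 A \<mu>2 B"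
    by simp
qed

end
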